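(* Let $p\ge1$, $0<N<1$, and let $(X,d,\mathfrak m)$ be a Lipschitz differentiability space for which there exists $r_0>0$ such that the function $\Theta_{N,r_0}(x):=\sup_{0<r\le r_0}\frac{\mathfrak m(B_r(x))}{r^N}$ is $\mathfrak m$-integrable on bounded subsets of $X$. Then for every $u\in\mathrm{Lip}_b(X,d)$, $$\lim_{\lambda\to+\infty}\lambda^p(\mathfrak m\times\mathfrak m)(E_{\lambda,u})=0,$$ where $$E_{\lambda,u}:=\Big\{(x,y)\in X\times X:\ x\ne y,\ |u(x)-u(y)|\ge\lambda\, d(x,y)^{\frac Np+1}\Big\}.$$
   Context: A metric measure space $(X,d,\mathfrak m)$ is a non-empty complete separable metric space $(X,d)$ with a Radon measure $\mathfrak m$ such that $0<\mathfrak m(U)<+\infty$ for every non-empty bounded open set $U\subset X$. $B_r(x):=\{y\in X: d(x,y)<r\}$. $\mathrm{Lip}(X,d)$ is the set of (globally) Lipschitz functions $u:X\to\mathbb R$, and $\mathrm{Lip}_b(X,d)$ the subset of those with bounded support. Lipschitz differentiability space: a chart of dimension $n\in\{0,1,2,\dots\}$ is a pair $(U,\phi)$ with $U\subset X$ Borel and $\phi:X\to\mathbb R^n$ Lipschitz. A function $u:X\to\mathbb R$ is differentiable at $x_0\in U$ with respect to $(U,\phi)$ if there is a unique $d_{x_0}u\in\mathbb R^n$ with $\limsup_{x\to x_0}\frac{|u(x)-u(x_0)-d_{x_0}u\cdot(\phi(x)-\phi(x_0))|}{d(x,x_0)}=0$. A metric measure space is a Lipschitz differentiability space if $X$ has a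 countable decomposition into charts (of possibly different dimensions) such that every $u\in\mathrm{Lip}(X,d)$ is differentiable at $\mathfrak m$-a.e. point of each chart. *)

theory Defs
  imports "HOL-Analysis.Analysis"
begin

text \<open>
  The metric space is the type \<open>'a\<close>; the class \<open>polish_space\<close> says that it is complete and
  second countable, i.e. separable, and types are non-empty.
\<close>

definition radon_measure :: "'a::metric_space measure \<Rightarrow> bool" where
  "radon_measure M \<longleftrightarrow>
     sets M = sets borel \<and>
     (\<forall>x. \<exists>U. open U \<and> x \<in> U \<and> emeasure M U < \<infinity>) \<and>
     (\<forall>A\<in>sets M. emeasure M A = (SUP K\<in>{K. compact K \<and> K \<subseteq> A}. emeasure M K))"

definition metric_measure_space :: "'a::polish_space measure \<Rightarrow> bool" where
  "metric_measure_space M \<longleftrightarrow>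
     radon_measure M \<and>
     (\<forall>U. open U \<and> bounded U \<and> U \<noteq> {} \<longrightarrow> 0 < emeasure M U \<and> emeasure M U < \<infinity>)"

definition Lip :: "('a::metric_space \<Rightarrow> real) set" where
  "Lip = {u. \<exists>L. L-lipschitz_on UNIV u}"

definition Lip_b :: "('a::metric_space \<Rightarrow> real) set" where
  "Lip_b = {u \<in> Lip. bounded (closure {x. u x \<noteq> 0})}"

text \<open>
  The dimension of a chart varies inside a single statement, so \<open>\<real>\<^sup>n\<close> cannot be a type. Its elements
  are functions on \<open>{..<n}\<close> that are \<open>undefined\<close> outside; with this normalisation equality of
  functions is equality of vectors, and \<open>\<real>\<^sup>0\<close> has exactly one element.
\<close>

definition Rn :: "nat \<Rightarrow> (nat \<Rightarrow> real) set" where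
  "Rn n = ({..<n} \<rightarrow>\<^sub>E UNIV)"

definition chart :: "nat \<Rightarrow> 'a::metric_space set \<Rightarrow> ('a \<Rightarrow> nat \<Rightarrow> real) \<Rightarrow> bool" where
  "chart n U \<phi> \<longleftrightarrow>
     U \<in> sets borel \<and> range \<phi> \<subseteq> Rn n \<and>
     (\<exists>L. \<forall>x y. L2_set (\<lambda>i. \<phi> x i - \<phi> y i) {..<n} \<le> L * dist x y)"

text \<open>
  The upper limit is taken in \<open>[0,\<infinity>]\<close>, over \<open>x \<noteq> x\<^sub>0\<close>. At an isolated point \<open>x\<^sub>0\<close> the filter
  \<open>at x\<^sub>0\<close> is trivial and the upper limit is the supremum of the empty set, which is 0.
\<close>

definition has_chart_differential ::
    "nat \<Rightarrow> ('a::metric_space \<Rightarrow> nat \<Rightarrow> real) \<Rightarrow> ('a \<Rightarrow> real) \<Rightarrow> 'a \<Rightarrow> (nat \<Rightarrow> real) \<Rightarrow> bool" where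
  "has_chart_differential n \<phi> u x\<^sub>0 D \<longleftrightarrow>
     Limsup (at x\<^sub>0)
       (\<lambda>x. ennreal (\<bar>u x - u x\<^sub>0 - (\<Sum>i<n. D i * (\<phi> x i - \<phi> x\<^sub>0 i))\<bar> / dist x x\<^sub>0)) = 0"

definition chart_differentiable ::
    "nat \<Rightarrow> ('a::metric_space \<Rightarrow> nat \<Rightarrow> real) \<Rightarrow> ('a \<Rightarrow> real) \<Rightarrow> 'a \<Rightarrow> bool" where
  "chart_differentiable n \<phi> u x\<^sub>0 \<longleftrightarrow> (\<exists>!D. D \<in> Rn n \<and> has_chart_differential n \<phi> u x\<^sub>0 D)"

text \<open>
  The chart domains may be empty, so finite decompositions are included as well.
\<close>

definition lipschitz_differentiability_space :: "'a::polish_space measure \<Rightarrow> bool" where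
  "lipschitz_differentiability_space M \<longleftrightarrow>
     metric_measure_space M \<and>
     (\<exists>(n :: nat \<Rightarrow> nat) (U :: nat \<Rightarrow> 'a set) (\<phi> :: nat \<Rightarrow> 'a \<Rightarrow> nat \<Rightarrow> real).
        (\<forall>i. chart (n i) (U i) (\<phi> i)) \<and>
        disjoint_family U \<and> (\<Union>i. U i) = UNIV \<and>
        (\<forall>i. \<forall>u\<in>Lip. AE x in M. x \<in> U i \<longrightarrow> chart_differentiable (n i) (\<phi> i) u x))"

definition Theta :: "'a::metric_space measure \<Rightarrow> real \<Rightarrow> real \<Rightarrow> 'a \<Rightarrow> ennreal" where
  "Theta M N r\<^sub>0 x = (SUP r\<in>{0<..r\<^sub>0}. emeasure M (ball x r) / ennreal (r powr N))"

definition integrable_on_bounded_sets :: "'a::metric_space measure \<Rightarrow> ('a \<Rightarrow> ennreal) \<Rightarrow> bool" where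
  "integrable_on_bounded_sets M f \<longleftrightarrow>
     f \<in> borel_measurable M \<and>
     (\<forall>B\<in>sets M. bounded B \<longrightarrow> (\<integral>\<^sup>+x\<in>B. f x \<partial>M) < \<infinity>)"

definition E_set :: "real \<Rightarrow> real \<Rightarrow> real \<Rightarrow> ('a::metric_space \<Rightarrow> real) \<Rightarrow> ('a \<times> 'a) set" where
  "E_set p N l u = {(x, y). x \<noteq> y \<and> \<bar>u x - u y\<bar> \<ge> l * dist x y powr (N / p + 1)}"

end

theory Submission
  imports Defs
begin

text \<open>
  The superlevel set has slices \<open>E\<^sub>x\<close> contained in balls of radius about \<open>(L / \<lambda>)\<^bsup>p/N\<^esup>\<close>, so
  \<open>\<lambda>\<^sup>p \<mu>(E\<^sub>x)\<close> is dominated by a multiple of the density function \<open>\<Theta>\<close> on a bounded set, and dominated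
  convergence reduces the claim to \<open>\<lambda>\<^sup>p \<mu>(E\<^sub>x) \<longlongrightarrow> 0\<close> for almost every \<open>x\<close>. This is clear where the
  slope of \<open>u\<close> vanishes, in particular in charts of dimension 0, and where the \<open>N\<close>-density of \<open>\<mu>\<close>
  vanishes. The remaining points, in a chart of positive dimension and with positive upper
  \<open>N\<close>-density, form a null set: a compact set \<open>K\<close> of such points has length zero by a covering
  argument, because \<open>N < 1\<close>. Near a compact set of length zero every Lipschitz function can be made
  locally constant by a uniformly small change that does not increase its Lipschitz constant. Adding
  up differences of such flattenings of a coordinate \<open>\<phi>\<^sub>0\<close> at rapidly decreasing scales gives a
  Lipschitz function that looks like \<open>\<phi>\<^sub>0\<close> at some scales and is constant at others, around most
  points of \<open>K\<close>. If \<open>K\<close> had positive measure, this function would have a differential at some of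
  these points, which would have to be both zero and nonzero.
\<close>

section \<open>Flattening a function near a compact set of zero length\<close>

definition pseudometric :: "('a \<Rightarrow> 'a \<Rightarrow> real) \<Rightarrow> bool" where
  "pseudometric \<rho> \<longleftrightarrow>
     (\<forall>x. \<rho> x x = 0) \<and> (\<forall>x y. \<rho> x y = \<rho> y x) \<and> (\<forall>x y z. \<rho> x z \<le> \<rho> x y + \<rho> y z)"

lemma pseudometric_nonneg:
  assumes "pseudometric \<rho>" shows "0 \<le> \<rho> x y"
proof -
  have "\<rho> x x \<le> \<rho> x y + \<rho> y x" "\<rho> x x = 0" "\<rho> y x = \<rho> x y"
    using assms unfolding pseudometric_def by blast+
  then show ?thesis by linarith
qed

text \<open>
  \<open>\<sigma>\<close> is \<open>\<rho>\<close> with \<open>B\<close> shrunk to a point: a function is 1-Lipschitz for \<open>\<sigma>\<close> iff it is 1-Lipschitz for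
  \<open>\<rho>\<close> and constant on \<open>B\<close>. Replacing the metric, and not only the function, is what makes the
  induction over several sets work: later steps cannot destroy the constancy on earlier sets.
\<close>

lemma collapse_one:
  assumes \<rho>: "pseudometric \<rho>" and f: "\<And>x y. \<bar>f x - f y\<bar> \<le> \<rho> x y"
    and B: "B \<noteq> {}" "\<And>x y. x \<in> B \<Longrightarrow> y \<in> B \<Longrightarrow> \<rho> x y \<le> e"
  obtains \<sigma> f' where "pseudometric \<sigma>" "\<And>x y. \<sigma> x y \<le> \<rho> x y"
    "\<And>x y. x \<in> B \<Longrightarrow> y \<in> B \<Longrightarrow> \<sigma> x y = 0"
    "\<And>x y. \<bar>f' x - f' y\<bar> \<le> \<sigma> x y" "\<And>x. f x - e \<le> f' x" "\<And>x. f' x \<le> f x"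
proof -
  have r0: "\<rho> x x = 0" and sym: "\<rho> x y = \<rho> y x" and tri: "\<rho> x z \<le> \<rho> x y + \<rho> y z" for x y z
    using \<rho> unfolding pseudometric_def by blast+
  have nn: "0 \<le> \<rho> x y" for x y using pseudometric_nonneg[OF \<rho>] .
  \<comment> \<open>\<open>h\<close> is the \<open>\<rho>\<close>-distance to \<open>B\<close>. In
    \<open>\<sigma>\<close> one goes from \<open>x\<close> to \<open>y\<close> either directly or
    through \<open>B\<close>, inside which travel is free.\<close>
  define h where "h = (\<lambda>x. INF b\<in>B. \<rho> x b)"
  define \<sigma> where "\<sigma> = (\<lambda>x y. min (\<rho> x y) (h x + h y))"
  have bdd: "bdd_below ((\<lambda>b. \<rho> x b) ` B)" for x
    by (rule bdd_belowI2[of _ 0]) (rule nn)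
  have h_le: "h x \<le> \<rho> x b" if "b \<in> B" for x b
    unfolding h_def by (rule cINF_lower[OF bdd that])
  have h_ge: "c \<le> h x" if "\<And>b. b \<in> B \<Longrightarrow> c \<le> \<rho> x b" for x c
    unfolding h_def by (rule cINF_greatest[OF B(1)]) (rule that)
  have h0: "0 \<le> h x" for x by (rule h_ge) (rule nn)
  have hB: "h x = 0" if "x \<in> B" for x
    using h_le[OF that, of x] h0[of x] r0[of x] by linarith
  have h_lip: "h x \<le> \<rho> x y + h y" for x y
  proof -
    have "h x - \<rho> x y \<le> h y"
    proof (rule h_ge)
      fix b assume "b \<in> B"
      then show "h x - \<rho> x y \<le> \<rho> y b" using h_le[of b x] tri[of x b y] by linarith
    qed
    then show ?thesis by linarith
  qed
  obtain b0 where b0: "b0 \<in> B" using B(1) by blast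
  have bddf: "bdd_below (f ` B)"
  proof (rule bdd_belowI2)
    fix x assume "x \<in> B"
    then show "f b0 - e \<le> f x" using f[of b0 x] B(2)[OF b0, of x] by linarith
  qed
  define c where "c = (INF b\<in>B. f b)"
  have c_le: "c \<le> f b" if "b \<in> B" for b
    unfolding c_def by (rule cINF_lower[OF bddf that])
  have c_ge: "f b - e \<le> c" if "b \<in> B" for b
    unfolding c_def
  proof (rule cINF_greatest[OF B(1)])
    fix x assume "x \<in> B"
    then show "f b - e \<le> f x" using f[of b x] B(2)[OF that, of x] by linarith
  qed
  \<comment> \<open>A minimum of two 1-Lipschitz functions. On \<open>B\<close> the second one
    equals \<open>c\<close>, which lies below \<open>f\<close>, so \<open>f'\<close> is
    \<open>c\<close> there. The loss is at most \<open>e\<close> because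
    \<open>f x \<le> f b + \<rho> x b \<le> c + e + \<rho> x b\<close> for every \<open>b\<close> in
    \<open>B\<close>.\<close>
  define f' where "f' = (\<lambda>x. min (f x) (c + h x))"
  have f'B: "f' x = c" if "x \<in> B" for x
    using c_le[OF that] hB[OF that] unfolding f'_def by simp
  have f'1: "\<bar>f' x - f' y\<bar> \<le> \<rho> x y" for x y
    using f[of x y] h_lip[of x y] h_lip[of y x] sym[of x y] unfolding f'_def by linarith
  have f'2: "\<bar>f' x - c\<bar> \<le> h x" for x
  proof (rule h_ge)
    fix b assume "b \<in> B"
    then show "\<bar>f' x - c\<bar> \<le> \<rho> x b" using f'1[of x b] f'B[of b] by simp
  qed
  have lower: "f x - e \<le> f' x" for x
  proof -
    have "f x - e - c \<le> h x"
    proof (rule h_ge)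
      fix b assume "b \<in> B"
      then show "f x - e - c \<le> \<rho> x b" using f[of x b] c_ge[of b] by linarith
    qed
    moreover have "0 \<le> e" using B(2)[OF b0 b0] r0 by simp
    ultimately show ?thesis unfolding f'_def by linarith
  qed
  show ?thesis
  proof (rule that)
    show "pseudometric \<sigma>" unfolding pseudometric_def
    proof (intro conjI allI)
      fix x y z
      show "\<sigma> x x = 0" unfolding \<sigma>_def using r0[of x] h0[of x] by simp
      show "\<sigma> x y = \<sigma> y x" unfolding \<sigma>_def using sym[of x y] by simp
      show "\<sigma> x z \<le> \<sigma> x y + \<sigma> y z"
        unfolding \<sigma>_def
        using tri[of x z y] h_lip[of x y] h_lip[of z y] sym[of z y] h0[of x] h0[of y] h0[of z]
        by linarith
    qed
    show "\<sigma> x y \<le> \<rho> x y" for x y unfolding \<sigma>_def by simp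
    show "\<sigma> x y = 0" if "x \<in> B" "y \<in> B" for x y
      unfolding \<sigma>_def using hB[OF that(1)] hB[OF that(2)] nn[of x y] by simp
    show "\<bar>f' x - f' y\<bar> \<le> \<sigma> x y" for x y
      unfolding \<sigma>_def using f'1[of x y] f'2[of x] f'2[of y] by linarith
    show "f' x \<le> f x" for x unfolding f'_def by simp
  qed (rule lower)
qed

text \<open>The sets are collapsed one after the other, each in the pseudometric left by the
  previous step. That pseudometric is bounded by \<open>\<rho>\<close>, so the diameter bounds
  \<open>e i\<close> persist, and the losses in \<open>f\<close> add up.\<close>

lemma collapse_many:
  assumes "finite I" "pseudometric \<rho>" "\<And>x y. \<bar>f x - f y\<bar> \<le> \<rho> x y"
    and "\<And>i x y. i \<in> I \<Longrightarrow> x \<in> B i \<Longrightarrow> y \<in> B i \<Longrightarrow> \<rho> x y \<le> e i"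
    and "\<And>i. i \<in> I \<Longrightarrow> B i \<noteq> {}"
  shows "\<exists>f'. (\<forall>x y. \<bar>f' x - f' y\<bar> \<le> \<rho> x y) \<and> (\<forall>i\<in>I. \<forall>x\<in>B i. \<forall>y\<in>B i. f' x = f' y) \<and>
              (\<forall>x. f x - sum e I \<le> f' x \<and> f' x \<le> f x)"
  using assms
proof (induction I arbitrary: \<rho> f rule: finite_induct)
  case empty
  then show ?case by (intro exI[of _ f]) simp
next
  case (insert j I)
  obtain \<sigma> g where \<sigma>: "pseudometric \<sigma>" "\<And>x y. \<sigma> x y \<le> \<rho> x y"
    "\<And>x y. x \<in> B j \<Longrightarrow> y \<in> B j \<Longrightarrow> \<sigma> x y = 0"
    and g: "\<And>x y. \<bar>g x - g y\<bar> \<le> \<sigma> x y" "\<And>x. f x - e j \<le> g x" "\<And>x. g x \<le> f x"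
  proof (rule collapse_one[OF insert.prems(1,2), of "B j" "e j"])
  qed (use insert.prems in auto)
  have "\<exists>f'. (\<forall>x y. \<bar>f' x - f' y\<bar> \<le> \<sigma> x y) \<and> (\<forall>i\<in>I. \<forall>x\<in>B i. \<forall>y\<in>B i. f' x = f' y) \<and>
              (\<forall>x. g x - sum e I \<le> f' x \<and> f' x \<le> g x)"
  proof (rule insert.IH[OF \<sigma>(1) g(1)])
    fix i x y assume "i \<in> I" "x \<in> B i" "y \<in> B i"
    then show "\<sigma> x y \<le> e i" using \<sigma>(2)[of x y] insert.prems(3)[of i x y] by force
  qed (use insert.prems in auto)
  then obtain f' where f': "\<And>x y. \<bar>f' x - f' y\<bar> \<le> \<sigma> x y"
    "\<And>i x y. i \<in> I \<Longrightarrow> x \<in> B i \<Longrightarrow> y \<in> B i \<Longrightarrow> f' x = f' y"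
    "\<And>x. g x - sum e I \<le> f' x" "\<And>x. f' x \<le> g x" by blast
  have "f' x = f' y" if "i \<in> insert j I" "x \<in> B i" "y \<in> B i" for i x y
  proof (cases "i = j")
    case True
    then show ?thesis using f'(1)[of x y] \<sigma>(3)[of x y] that by simp
  next
    case False
    then show ?thesis using that f'(2)[of i x y] by blast
  qed
  moreover have "\<bar>f' x - f' y\<bar> \<le> \<rho> x y" for x y
    using f'(1)[of x y] \<sigma>(2)[of x y] by linarith
  moreover have "f x - sum e (insert j I) \<le> f' x" "f' x \<le> f x" for x
    using f'(3,4)[of x] g(2,3)[of x] insert.hyps by simp_all
  ultimately show ?case by blast
qed

text \<open>
  For compact \<open>K\<close> this says that the one-dimensional Hausdorff measure of \<open>K\<close> vanishes.
\<close>

definition null_length :: "'a::metric_space set \<Rightarrow> bool" where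
  "null_length K \<longleftrightarrow> (\<forall>e>0. \<exists>F. finite F \<and> (\<forall>(x, r)\<in>F. 0 < r) \<and>
      K \<subseteq> (\<Union>(x, r)\<in>F. ball x r) \<and> (\<Sum>(x, r)\<in>F. r) < e)"

text \<open>Collapse every ball of a finite cover of \<open>K\<close> whose radii sum to less than
  \<open>e / 2\<close>. The losses are at most the diameters, in total less than \<open>e\<close>. A
  Lebesgue number of the cover serves as \<open>b\<close>.\<close>

lemma flatten:
  fixes f :: "'a::metric_space \<Rightarrow> real"
  assumes K: "compact K" "null_length K" and f: "\<And>x y. \<bar>f x - f y\<bar> \<le> dist x y" and "0 < e"
  obtains g b where "0 < b" "\<And>x y. \<bar>g x - g y\<bar> \<le> dist x y" "\<And>x. \<bar>g x - f x\<bar> \<le> e"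
    "\<And>x y. x \<in> K \<Longrightarrow> dist x y < b \<Longrightarrow> g y = g x"
proof -
  obtain F :: "('a \<times> real) set" where F: "finite F" "\<And>i. i \<in> F \<Longrightarrow> 0 < snd i"
    "K \<subseteq> (\<Union>i\<in>F. ball (fst i) (snd i))" "(\<Sum>i\<in>F. snd i) < e / 2"
    using K(2)[unfolded null_length_def, rule_format, of "e / 2"] \<open>0 < e\<close>
    by (auto simp: case_prod_beta)
  define B where "B = (\<lambda>i::'a \<times> real. ball (fst i) (snd i))"
  have "\<exists>g. (\<forall>x y. \<bar>g x - g y\<bar> \<le> dist x y) \<and> (\<forall>i\<in>F. \<forall>x\<in>B i. \<forall>y\<in>B i. g x = g y) \<and>
              (\<forall>x. f x - (\<Sum>i\<in>F. 2 * snd i) \<le> g x \<and> g x \<le> f x)"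
  proof (rule collapse_many[OF F(1) _ f])
    show "pseudometric (dist :: 'a \<Rightarrow> _)"
      unfolding pseudometric_def by (auto simp: dist_commute dist_triangle)
    show "dist x y \<le> 2 * snd i" if "i \<in> F" "x \<in> B i" "y \<in> B i" for i x y
      using that dist_triangle3[of x y "fst i"] unfolding B_def by simp
    show "B i \<noteq> {}" if "i \<in> F" for i using F(2)[OF that] unfolding B_def by simp
  qed
  then obtain g where g: "\<And>x y. \<bar>g x - g y\<bar> \<le> dist x y"
    "\<And>i x y. i \<in> F \<Longrightarrow> x \<in> B i \<Longrightarrow> y \<in> B i \<Longrightarrow> g x = g y"
    "\<And>x. f x - (\<Sum>i\<in>F. 2 * snd i) \<le> g x" "\<And>x. g x \<le> f x" by blast
  have "(\<Sum>i\<in>F. 2 * snd i) < e" using F(4) by (simp flip: sum_distrib_left)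
  then have close: "\<bar>g x - f x\<bar> \<le> e" for x using g(3,4)[of x] by linarith
  obtain b where b: "0 < b" "\<forall>x\<in>K. \<exists>G\<in>B ` F. ball x b \<subseteq> G"
  proof (rule Heine_Borel_lemma[OF K(1), of "B ` F"])
    show "K \<subseteq> \<Union> (B ` F)" using F(3) unfolding B_def by simp
  qed (auto simp: B_def)
  have "g y = g x" if xy: "x \<in> K" "dist x y < b" for x y
  proof -
    obtain i where i: "i \<in> F" "ball x b \<subseteq> B i" using b(2) xy(1) by blast
    then have "x \<in> B i" "y \<in> B i" using xy(2) b(1) by (auto simp: subset_eq)
    then show ?thesis using g(2) i(1) by metis
  qed
  then show ?thesis using that b(1) g(1) close by blast
qed

section \<open>Oscillating Lipschitz functions\<close>

definition recurrent :: "('a::metric_space \<Rightarrow> 'a \<Rightarrow> bool) \<Rightarrow> 'a \<Rightarrow> bool" where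
  "recurrent Q x \<longleftrightarrow> (\<forall>b>0. \<exists>y. 0 < dist x y \<and> dist x y < b \<and> Q x y)"

text \<open>
  An Egorov-type uniformisation: outside a small set, the points \<open>y\<close> that witness the recurrence at
  \<open>x\<close> below scale \<open>b\<close> can be found above a scale \<open>a\<close> that does not depend on \<open>x\<close>.
\<close>

lemma window:
  fixes M :: "'a::metric_space measure"
  assumes M: "sets M = sets borel" and K: "K \<in> sets M" "emeasure M K < \<infinity>"
    and I: "finite I" and Q: "\<And>i y. open {x. Q i x y}" and b: "0 < b" and e: "0 < (e::real)"
  obtains a G where "0 < a" "a < b" "G \<in> sets M" "G \<subseteq> K" "emeasure M (K - G) \<le> e"
    "\<And>x i. x \<in> G \<Longrightarrow> i \<in> I \<Longrightarrow> recurrent (Q i) x \<Longrightarrow> \<exists>y. a < dist x y \<and> dist x y < b \<and> Q i x y"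
proof -
  define W where "W = (\<lambda>i a. {x. \<exists>y. a < dist x y \<and> dist x y < b \<and> Q i x y})"
  have W_open: "open (W i a)" for i a
  proof -
    \<comment> \<open>As a union over all \<open>y\<close>, possibly uncountable, the set is open
      because each test is open in its first argument.\<close>
    have "W i a = (\<Union>y. {x. a < dist x y} \<inter> {x. dist x y < b} \<inter> {x. Q i x y})"
      unfolding W_def by blast
    also have "open \<dots>"
      by (intro open_UN open_Int ballI Q open_Collect_less continuous_intros)
    finally show ?thesis .
  qed
  \<comment> \<open>The summand 2 gives \<open>R n < b\<close> already for
    \<open>n = 0\<close>.\<close>
  define R where "R = (\<lambda>n::nat. b / (real n + 2))"
  have R: "0 < R n" "R n < b" for n using b unfolding R_def by (auto simp: field_simps add_pos_nonneg)
  \<comment> \<open>The exceptional points: some test has a witness below scale \<open>b\<close>,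
    but none above scale \<open>R n\<close>.\<close>
  define N where "N = (\<lambda>n. K \<inter> (\<Union>i\<in>I. W i 0 - W i (R n)))"
  have Ns: "N n \<in> sets M" for n
  proof -
    have "W i a \<in> sets M" for i a using borel_open[OF W_open] M by blast
    then show ?thesis
      unfolding N_def by (intro sets.Int sets.finite_UN sets.Diff K(1) I)
  qed
  have Rmono: "R n \<le> R m" if "m \<le> n" for m n
    unfolding R_def using that b by (intro divide_left_mono) auto
  have "W i (R m) \<subseteq> W i (R n)" if "m \<le> n" for i m n
    unfolding W_def using Rmono[OF that] by force
  then have dec: "decseq N" unfolding N_def decseq_def by blast
  \<comment> \<open>At a point of all \<open>N n\<close>, one and the same test \<open>i\<close>
    would fail for infinitely many \<open>n\<close>, since \<open>I\<close> is finite. But a single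
    witness \<open>y\<close> lies above \<open>R n\<close> for all large \<open>n\<close>.\<close>
  have "(\<Inter>n. N n) = {}"
  proof (rule ccontr)
    assume "(\<Inter>n. N n) \<noteq> {}"
    then obtain x where x: "\<And>n. x \<in> N n" by blast
    have "\<forall>n. \<exists>i\<in>I. x \<in> W i 0 - W i (R n)" using x unfolding N_def by blast
    then have "\<exists>i\<in>I. infinite {n \<in> UNIV. x \<in> W i 0 - W i (R n)}"
      using I by (intro pigeonhole_infinite_rel) auto
    then obtain i where i: "i \<in> I" "\<exists>\<^sub>\<infinity>n. x \<in> W i 0 - W i (R n)"
      unfolding frequently_cofinite by auto
    have inf: "\<exists>m\<ge>n. x \<in> W i 0 - W i (R m)" for n
      using i(2) by (simp add: INFM_nat_le)
    then obtain y where y: "0 < dist x y" "dist x y < b" "Q i x y" unfolding W_def by blast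
    obtain n where n: "b / dist x y < real n" using reals_Archimedean2 by blast
    have "R m < dist x y" if "n \<le> m" for m
    proof -
      have "b < real n * dist x y" using n y(1) by (simp add: field_simps)
      also have "\<dots> \<le> (real m + 2) * dist x y" using that y(1) by (intro mult_right_mono) auto
      finally show ?thesis unfolding R_def by (simp add: field_simps)
    qed
    then have "x \<in> W i (R m)" if "n \<le> m" for m using that y unfolding W_def by blast
    then show False using inf[of n] by blast
  qed
  moreover have "(\<lambda>n. emeasure M (N n)) \<longlonglongrightarrow> emeasure M (\<Inter>n. N n)"
  proof (rule Lim_emeasure_decseq)
    show "emeasure M (N i) \<noteq> \<infinity>" for i
      using emeasure_mono[of "N i" K M] K unfolding N_def by (auto simp: top_unique)
  qed (use Ns dec in auto)
  ultimately have "(\<lambda>n. emeasure M (N n)) \<longlonglongrightarrow> 0" by simp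
  then have "eventually (\<lambda>n. emeasure M (N n) < ennreal e) sequentially"
    by (rule order_tendstoD(2)) (use e in auto)
  then obtain n where n: "emeasure M (N n) < ennreal e"
    using eventually_happens'[of sequentially] by auto
  show ?thesis
  proof (rule that[of "R n" "K - N n"])
    have "K - (K - N n) = N n" unfolding N_def by blast
    then show "emeasure M (K - (K - N n)) \<le> e" using n by simp
    show "\<exists>y. R n < dist x y \<and> dist x y < b \<and> Q i x y"
      if "x \<in> K - N n" "i \<in> I" "recurrent (Q i) x" for x i
    proof -
      have "x \<in> W i 0" using that(3) b unfolding recurrent_def W_def by blast
      then have "x \<in> W i (R n)" using that(1,2) unfolding N_def by blast
      then show ?thesis unfolding W_def by blast
    qed
  qed (use R Ns K in auto)
qed

text \<open>
  \<open>g\<close> lives at the scales between \<open>t\<close> and \<open>s\<close> around \<open>K\<close>, where it copies the increments of \<open>f\<close> at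
  some scales and is constant at others; the tests \<open>Q i\<close> are passed by witnesses at both kinds of
  scales.
\<close>

definition oscillation where
  "oscillation M K f Q I s e g t G \<longleftrightarrow> 0 < t \<and> t < s \<and> G \<in> sets M \<and> G \<subseteq> K \<and>
    emeasure M (K - G) \<le> ennreal e \<and>
    (\<forall>x y. \<bar>g x - g y :: real\<bar> \<le> 3 * dist x y) \<and> (\<forall>x. \<bar>g x\<bar> \<le> e * s) \<and>
    (\<forall>x. (\<forall>z\<in>K. s \<le> dist x z) \<longrightarrow> g x = 0) \<and>
    (\<forall>z\<in>K. \<forall>x. dist z x < t \<longrightarrow> g x = g z) \<and>
    (\<forall>x\<in>G. \<forall>i\<in>I. recurrent (Q i) x \<longrightarrow>
       (\<exists>y. t < dist x y \<and> dist x y < s \<and> Q i x y \<and> \<bar>g y - g x - (f y - f x)\<bar> \<le> e * dist x y)) \<and>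
    (\<forall>x\<in>G. \<forall>i\<in>I. recurrent (Q i) x \<longrightarrow>
       (\<exists>y. t < dist x y \<and> dist x y < s \<and> Q i x y \<and> g y = g x))"

text \<open>Up to a cutoff, \<open>g\<close> is the difference \<open>q - p\<close> of two
  flattenings of \<open>f\<close>, with \<open>q\<close> much closer to \<open>f\<close> than
  \<open>p\<close>. Between the scales \<open>a1\<close> and \<open>b1\<close>, \<open>p\<close> is
  constant and \<open>q\<close> is close to \<open>f\<close>, so \<open>g\<close> copies
  \<open>f\<close>; below \<open>b2\<close> both are constant. Each range of scales is taken from
  \<open>window\<close>, so that witnesses for all tests occur in it.\<close>

lemma oscillation_step:
  fixes M :: "'a::metric_space measure" and f :: "'a \<Rightarrow> real"
  assumes M: "sets M = sets borel" and K: "compact K" "K \<noteq> {}" "null_length K" "emeasure M K < \<infinity>"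
    and f: "\<And>x y. \<bar>f x - f y\<bar> \<le> dist x y" and s: "0 < s" and e: "0 < e"
    and I: "finite I" and Q: "\<And>i y. open {x. Q i x y}"
  shows "\<exists>g t G. oscillation M K f Q I s e g t G"
proof -
  have KM: "K \<in> sets M" unfolding M by (rule borel_compact[OF K(1)])
  \<comment> \<open>The bound \<open>s / 4\<close> keeps the Lipschitz constant of the cut-off
    function at 3, and \<open>e * s / 2\<close> gives its sup bound.\<close>
  define e1 where "e1 = min (s / 4) (e * s / 2)"
  have e1: "0 < e1" "4 * e1 \<le> s" "2 * e1 \<le> e * s" using s e unfolding e1_def by auto
  obtain p b where p: "0 < b" "\<And>x y. \<bar>p x - p y\<bar> \<le> dist x y" "\<And>x. \<bar>p x - f x\<bar> \<le> e1"
    "\<And>x y. x \<in> K \<Longrightarrow> dist x y < b \<Longrightarrow> p y = p x"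
    by (rule flatten[OF K(1,3) f e1(1)]) (rule that)
  define b1 where "b1 = min b (s / 2)"
  have b1: "0 < b1" "b1 \<le> b" "b1 \<le> s / 2" using p(1) s unfolding b1_def by auto
  obtain a1 G1 where a1: "0 < a1" "a1 < b1" "G1 \<in> sets M" "G1 \<subseteq> K" "emeasure M (K - G1) \<le> ennreal (e / 2)"
    "\<And>x i. x \<in> G1 \<Longrightarrow> i \<in> I \<Longrightarrow> recurrent (Q i) x \<Longrightarrow> \<exists>y. a1 < dist x y \<and> dist x y < b1 \<and> Q i x y"
    by (rule window[where Q=Q, OF M KM K(4) I Q b1(1) half_gt_zero[OF e]]) (rule that)
  \<comment> \<open>An error of \<open>2 * e2\<close> in the increments of \<open>q\<close> is at
    most \<open>e\<close> times any distance above \<open>a1\<close>.\<close>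
  define e2 where "e2 = min e1 (e * a1 / 2)"
  have e2: "0 < e2" "e2 \<le> e1" "2 * e2 \<le> e * a1" using e1 e a1 unfolding e2_def by auto
  obtain q b' where q: "0 < b'" "\<And>x y. \<bar>q x - q y\<bar> \<le> dist x y" "\<And>x. \<bar>q x - f x\<bar> \<le> e2"
    "\<And>x y. x \<in> K \<Longrightarrow> dist x y < b' \<Longrightarrow> q y = q x"
    by (rule flatten[OF K(1,3) f e2(1)]) (rule that)
  define b2 where "b2 = min b' a1"
  have b2: "0 < b2" "b2 \<le> b'" "b2 \<le> a1" using q(1) a1 unfolding b2_def by auto
  obtain a2 G2 where a2: "0 < a2" "a2 < b2" "G2 \<in> sets M" "G2 \<subseteq> K" "emeasure M (K - G2) \<le> ennreal (e / 2)"
    "\<And>x i. x \<in> G2 \<Longrightarrow> i \<in> I \<Longrightarrow> recurrent (Q i) x \<Longrightarrow> \<exists>y. a2 < dist x y \<and> dist x y < b2 \<and> Q i x y"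
    by (rule window[where Q=Q, OF M KM K(4) I Q b2(1) half_gt_zero[OF e]]) (rule that)
  \<comment> \<open>A cutoff with slope \<open>2 / s\<close>, equal to 1 within \<open>s / 2\<close>
    of \<open>K\<close> and to 0 from distance \<open>s\<close> on.\<close>
  define c where "c = (\<lambda>x. min 1 (max 0 (2 - 2 / s * infdist x K)))"
  have c01: "0 \<le> c x" "c x \<le> 1" for x unfolding c_def by auto
  have c_lip: "\<bar>c x - c y\<bar> \<le> 2 / s * dist x y" for x y
  proof -
    have "\<bar>2 / s * infdist x K - 2 / s * infdist y K\<bar> = 2 / s * \<bar>infdist x K - infdist y K\<bar>"
      unfolding right_diff_distrib[symmetric] abs_mult using s by simp
    also have "\<dots> \<le> 2 / s * dist x y"
      using s by (intro mult_left_mono infdist_triangle_abs) auto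
    finally have "\<bar>2 / s * infdist x K - 2 / s * infdist y K\<bar> \<le> 2 / s * dist x y" .
    then show ?thesis unfolding c_def by linarith
  qed
  have c1: "c x = 1" if "z \<in> K" "dist z x < s / 2" for x z
  proof -
    have "infdist x K < s / 2" using infdist_le[OF that(1), of x] that(2) by (simp add: dist_commute)
    then have "2 / s * infdist x K \<le> 1" using s by (simp add: field_simps)
    then show ?thesis unfolding c_def by simp
  qed
  define g where "g = (\<lambda>x. c x * (q x - p x))"
  have h: "\<bar>q x - p x\<bar> \<le> 2 * e1" for x using p(3)[of x] q(3)[of x] e2(2) by linarith
  have g_near: "g x = q x - p z" if "z \<in> K" "dist z x < b1" for x z
    using c1[OF that(1), of x] p(4)[OF that(1), of x] that(2) b1 unfolding g_def by simp
  have g_self: "g x = q x - p x" if "x \<in> K" for x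
    using g_near[OF that, of x] b1(1) by simp
  have g_const: "g x = g z" if "z \<in> K" "dist z x < b2" for x z
    using g_near[OF that(1), of x] g_self[OF that(1)] q(4)[OF that(1), of x] that(2) b2 a1(2) by simp
  have "oscillation M K f Q I s e g a2 (G1 \<inter> G2)"
    unfolding oscillation_def
  proof (intro conjI allI ballI impI)
    show "emeasure M (K - G1 \<inter> G2) \<le> ennreal e"
    proof -
      have "emeasure M (K - G1 \<inter> G2) = emeasure M ((K - G1) \<union> (K - G2))" by (simp add: Diff_Int)
      also have "\<dots> \<le> emeasure M (K - G1) + emeasure M (K - G2)"
        by (rule emeasure_subadditive) (use KM a1 a2 in auto)
      also have "\<dots> \<le> ennreal (e / 2) + ennreal (e / 2)" by (intro add_mono a1 a2)
      also have "\<dots> = ennreal e" using e by (simp flip: ennreal_plus)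
      finally show ?thesis .
    qed
    show "\<bar>g x - g y\<bar> \<le> 3 * dist x y" for x y
    proof -
      \<comment> \<open>Product rule: the first term contributes the Lipschitz constant 2, the
        second \<open>4 * e1 / s \<le> 1\<close>.\<close>
      have "g x - g y = c x * ((q x - p x) - (q y - p y)) + (c x - c y) * (q y - p y)"
        unfolding g_def by (simp add: algebra_simps)
      then have "\<bar>g x - g y\<bar> \<le> \<bar>c x\<bar> * \<bar>(q x - p x) - (q y - p y)\<bar> + \<bar>c x - c y\<bar> * \<bar>q y - p y\<bar>"
        by (metis abs_mult abs_triangle_ineq)
      also have "\<dots> \<le> 1 * (2 * dist x y) + (2 / s * dist x y) * (2 * e1)"
        using c01[of x] p(2)[of x y] q(2)[of x y] c_lip[of x y] h[of y] s
        by (intro add_mono mult_mono) auto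
      also have "\<dots> = 2 * dist x y + (4 * e1 / s) * dist x y" by simp
      also have "\<dots> \<le> 2 * dist x y + 1 * dist x y"
        using e1 s by (intro add_left_mono mult_right_mono) auto
      finally show ?thesis by simp
    qed
    show "\<bar>g x\<bar> \<le> e * s" for x
    proof -
      have "\<bar>g x\<bar> = c x * \<bar>q x - p x\<bar>" unfolding g_def using c01[of x] by (simp add: abs_mult)
      also have "\<dots> \<le> 1 * (2 * e1)" using c01[of x] h[of x] by (intro mult_mono) auto
      finally show ?thesis using e1 by simp
    qed
    show "g x = 0" if "\<forall>z\<in>K. s \<le> dist x z" for x
    proof -
      have "s \<le> infdist x K"
        unfolding infdist_notempty[OF K(2)] by (rule cINF_greatest[OF K(2)]) (use that in blast)
      then have "2 \<le> 2 / s * infdist x K" using s by (simp add: field_simps)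
      then show ?thesis unfolding g_def c_def by simp
    qed
    show "\<exists>y. a2 < dist x y \<and> dist x y < s \<and> Q i x y \<and> \<bar>g y - g x - (f y - f x)\<bar> \<le> e * dist x y"
      if x: "x \<in> G1 \<inter> G2" "i \<in> I" "recurrent (Q i) x" for x i
    proof -
      obtain y where y: "a1 < dist x y" "dist x y < b1" "Q i x y" using a1(6)[of x i] x by auto
      have xK: "x \<in> K" using x a1 by auto
      have "g y - g x = q y - q x" using g_near[OF xK y(2)] g_self[OF xK] by simp
      then have "\<bar>g y - g x - (f y - f x)\<bar> \<le> e * a1" using q(3)[of x] q(3)[of y] e2 by linarith
      also have "\<dots> \<le> e * dist x y" using y(1) e by simp
      finally show ?thesis using y b1 b2 a2 s by (intro exI[of _ y]) auto
    qed
    show "\<exists>y. a2 < dist x y \<and> dist x y < s \<and> Q i x y \<and> g y = g x"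
      if x: "x \<in> G1 \<inter> G2" "i \<in> I" "recurrent (Q i) x" for x i
    proof -
      obtain y where y: "a2 < dist x y" "dist x y < b2" "Q i x y" using a2(6)[of x i] x by auto
      have "x \<in> K" using x a1 by auto
      then have "g y = g x" using g_const y(2) by blast
      then show ?thesis using y b1 b2 a1 s by (intro exI[of _ y]) auto
    qed
    show "g x = g z" if "z \<in> K" "dist z x < a2" for z x
      using g_const that a2(2) by force
  qed (use a1 a2 b1 b2 in auto)
  then show ?thesis by blast
qed

text \<open>Sum oscillations \<open>g k\<close> living on separated ranges of scales from
  \<open>t k\<close> to \<open>s k\<close>. Around a point of \<open>K\<close> and at such a
  distance, earlier summands are constant and later ones tiny, so \<open>u\<close> has nearly the
  increments of \<open>g k\<close>. Step \<open>k\<close> handles the tests \<open>i < k\<close>;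
  thus each step has finitely many, and every test is handled in all but finitely many
  steps.\<close>

lemma oscillating_function:
  fixes M :: "'a::metric_space measure" and f :: "'a \<Rightarrow> real" and Q :: "nat \<Rightarrow> 'a \<Rightarrow> 'a \<Rightarrow> bool"
  assumes M: "sets M = sets borel" and K: "compact K" "K \<noteq> {}" "null_length K" "emeasure M K < \<infinity>"
    and f: "\<And>x y. \<bar>f x - f y\<bar> \<le> dist x y" and Q: "\<And>i y. open {x. Q i x y}" and e: "0 < e"
  obtains u G where "G \<in> sets M" "G \<subseteq> K" "emeasure M (K - G) \<le> ennreal e"
    "\<And>x y. \<bar>u x - u y\<bar> \<le> 7 * dist x y"
    "\<And>x i d. x \<in> G \<Longrightarrow> recurrent (Q i) x \<Longrightarrow> 0 < d \<Longrightarrow>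
       \<exists>y. 0 < dist x y \<and> dist x y < d \<and> Q i x y \<and> \<bar>u y - u x - (f y - f x)\<bar> \<le> d * dist x y"
    "\<And>x i d. x \<in> G \<Longrightarrow> recurrent (Q i) x \<Longrightarrow> 0 < d \<Longrightarrow>
       \<exists>y. 0 < dist x y \<and> dist x y < d \<and> Q i x y \<and> \<bar>u y - u x\<bar> \<le> d * dist x y"
proof -
  \<comment> \<open>The exceptional sets have total measure at most \<open>2 * c \<le> e\<close>;
    \<open>c \<le> 1 / 2\<close> keeps the difference of two values of \<open>g k\<close> below
    \<open>(1/2)^k * s k\<close>.\<close>
  define c where "c = min e 1 / 2"
  have c: "0 < c" "c \<le> 1 / 2" "2 * c \<le> e" using e unfolding c_def by auto
  define P where "P = (\<lambda>k s. oscillation M K f Q {..<k} s (c * (1/2)^k))"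
  have "\<exists>g t G. P k s g t G" if s: "0 < s" for k s
  proof -
    have "0 < c * (1/2)^k" using c by simp
    then show ?thesis
      unfolding P_def using oscillation_step[where Q=Q, OF M K f s _ finite_lessThan Q] by blast
  qed
  then have "\<forall>k s. \<exists>g t G. 0 < s \<longrightarrow> P k s g t G" by blast
  then obtain g0 t0 G0 where P0: "\<And>k s. 0 < s \<Longrightarrow> P k s (g0 k s) (t0 k s) (G0 k s)" by metis
  \<comment> \<open>Halving \<open>t k\<close> ensures that points within \<open>2 * s j\<close> of
    some \<open>z\<close> in \<open>K\<close> lie where every summand before \<open>g j\<close> has
    its value at \<open>z\<close>.\<close>
  define s where "s = rec_nat (1::real) (\<lambda>k r. t0 k r / 2)"
  define g t G where "g = (\<lambda>k. g0 k (s k))" and "t = (\<lambda>k. t0 k (s k))" and "G = (\<lambda>k. G0 k (s k))"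
  have s0: "s 0 = 1" and sS: "s (Suc k) = t k / 2" for k unfolding s_def t_def by simp_all
  have spos: "0 < s k" for k
  proof (induction k)
    case (Suc k)
    then show ?case using P0[of "s k" k] unfolding sS t_def P_def oscillation_def by simp
  qed (simp add: s0)
  have P: "P k (s k) (g k) (t k) (G k)" for k unfolding g_def t_def G_def by (rule P0[OF spos])
  have t: "0 < t k" "t k < s k" for k using P[of k] unfolding P_def oscillation_def by auto
  have G: "G k \<in> sets M" "G k \<subseteq> K" "emeasure M (K - G k) \<le> ennreal (c * (1/2)^k)" for k
    using P[of k] unfolding P_def oscillation_def by auto
  have g_lip: "\<bar>g k x - g k y\<bar> \<le> 3 * dist x y" and g_le: "\<bar>g k x\<bar> \<le> c * (1/2)^k * s k"
    for k x y using P[of k] unfolding P_def oscillation_def by auto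
  have g_far: "(\<forall>z\<in>K. s k \<le> dist x z) \<Longrightarrow> g k x = 0" for k x
    using P[of k] unfolding P_def oscillation_def by auto
  have g_near: "g k x = g k z" if "z \<in> K" "dist z x < t k" for k x z
    using P[of k] that unfolding P_def oscillation_def by metis
  have w1: "\<exists>y. t k < dist x y \<and> dist x y < s k \<and> Q i x y \<and>
      \<bar>g k y - g k x - (f y - f x)\<bar> \<le> c * (1/2)^k * dist x y"
    and w2: "\<exists>y. t k < dist x y \<and> dist x y < s k \<and> Q i x y \<and> g k y = g k x"
    if "x \<in> G k" "i < k" "recurrent (Q i) x" for k i x
    using P[of k] that unfolding P_def oscillation_def by auto
  have s_dec: "s (Suc k) \<le> s k / 2" for k using t[of k] unfolding sS by simp
  have s_anti: "s j \<le> s i" if "i \<le> j" for i j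
    using that by (rule lift_Suc_antimono_le[rotated]) (use s_dec spos in \<open>smt (verit) field_sum_of_halves\<close>)
  have s_t: "2 * s j \<le> t i" if "i < j" for i j
    using s_anti[of "Suc i" j] that unfolding sS by simp
  have s_pow: "s k \<le> (1/2)^k" for k
  proof (induction k)
    case (Suc k)
    then show ?case using s_dec[of k] by simp
  qed (simp add: s0)
  have g_pow: "\<bar>g k x\<bar> \<le> 1 / 2 * (1/2)^k * s k" for k x
  proof -
    have "c * (1/2)^k * s k \<le> 1 / 2 * (1/2)^k * s k"
      using c spos[of k] by (intro mult_right_mono) auto
    then show ?thesis using g_le[of k x] by linarith
  qed
  have summ: "summable (\<lambda>k. g k x)" for x
  proof (rule summable_comparison_test'[of "\<lambda>k. (1/2::real)^k"])
    show "summable (\<lambda>k. (1/2::real)^k)" by (simp add: summable_geometric)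
    fix k
    have "1 / 2 * (1/2)^k * s k \<le> 1 * (1/2)^k * 1"
      using s_anti[of 0 k] s0 spos[of k] by (intro mult_mono) auto
    then show "norm (g k x) \<le> (1/2)^k" using g_pow[of k x] unfolding real_norm_def by linarith
  qed
  define u where "u = (\<lambda>x. \<Sum>k. g k x)"
  \<comment> \<open>Adding Lipschitz constants would diverge. The bound starts at 3 and grows by
    \<open>2 * (1/2)^k\<close> in step \<open>k\<close>, so it stays below 7.\<close>
  have partial: "\<bar>(\<Sum>j<k. g j x) - (\<Sum>j<k. g j y)\<bar> \<le> (7 - 4 * (1/2)^k) * dist x y" for k x y
  proof (induction k)
    case 0
    then show ?case by simp
  next
    case (Suc k)
    have both: "\<bar>(\<Sum>j<Suc k. g j x) - (\<Sum>j<Suc k. g j y)\<bar> \<le> (7 - 4 * (1/2)^(Suc k)) * dist x y"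
      if z: "z \<in> K" "dist x z < 2 * s k" "dist y z < 2 * s k" for z
    proof -
      have "g j x = g j y" if "j < k" for j
        using g_near[OF z(1), of x j] g_near[OF z(1), of y j] z s_t[OF that] by (simp add: dist_commute)
      then have "(\<Sum>j<k. g j x) = (\<Sum>j<k. g j y)" by simp
      then have "\<bar>(\<Sum>j<Suc k. g j x) - (\<Sum>j<Suc k. g j y)\<bar> \<le> 3 * dist x y"
        using g_lip[of k x y] by simp
      also have "\<dots> \<le> (7 - 4 * (1/2)^(Suc k)) * dist x y"
        by (intro mult_right_mono) (use power_le_one[of "1/2::real" k] in auto)
      finally show ?thesis .
    qed
    \<comment> \<open>Far apart points are handled by the sup bound on \<open>g k\<close>. If close
      points have different values of \<open>g k\<close>, one of them is within \<open>s k\<close>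
      of some \<open>z\<close> in \<open>K\<close> and the other within \<open>2 * s k\<close>; then
      all earlier summands agree and only the constant 3 of \<open>g k\<close> counts.\<close>
    consider "s k \<le> dist x y" | "g k x = g k y" | z where "dist x y < s k" "z \<in> K" "dist x z < s k \<or> dist y z < s k"
      using g_far[of k x] g_far[of k y] by force
    then show ?case
    proof cases
      case 1
      have "\<bar>g k x - g k y\<bar> \<le> (1/2)^k * s k"
        using g_pow[of k x] g_pow[of k y] by linarith
      also have "\<dots> \<le> (1/2)^k * dist x y" using 1 by (intro mult_left_mono) auto
      also have "\<dots> \<le> 2 * (1/2)^k * dist x y" by (intro mult_right_mono) auto
      finally have "\<bar>(\<Sum>j<Suc k. g j x) - (\<Sum>j<Suc k. g j y)\<bar>
        \<le> (7 - 4 * (1/2)^k) * dist x y + 2 * (1/2)^k * dist x y" using Suc.IH by simp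
      also have "\<dots> = (7 - 4 * (1/2)^(Suc k)) * dist x y" by (simp add: algebra_simps)
      finally show ?thesis .
    next
      case 2
      then have "\<bar>(\<Sum>j<Suc k. g j x) - (\<Sum>j<Suc k. g j y)\<bar> \<le> (7 - 4 * (1/2)^k) * dist x y"
        using Suc.IH by simp
      also have "\<dots> \<le> (7 - 4 * (1/2)^(Suc k)) * dist x y"
        by (intro mult_right_mono) auto
      finally show ?thesis .
    next
      case (3 z)
      then have "dist x z < 2 * s k" "dist y z < 2 * s k"
        using dist_triangle[of x z y] dist_triangle3[of y z x] spos[of k] by auto
      then show ?thesis using both 3(2) by blast
    qed
  qed
  have u_lip: "\<bar>u x - u y\<bar> \<le> 7 * dist x y" for x y
  proof (rule tendsto_upperbound)
    show "(\<lambda>k. \<bar>(\<Sum>j<k. g j x) - (\<Sum>j<k. g j y)\<bar>) \<longlonglongrightarrow> \<bar>u x - u y\<bar>"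
      unfolding u_def by (intro tendsto_intros summable_LIMSEQ summ)
    show "\<forall>\<^sub>F k in sequentially. \<bar>(\<Sum>j<k. g j x) - (\<Sum>j<k. g j y)\<bar> \<le> 7 * dist x y"
    proof (intro always_eventually allI)
      fix k
      have "(7 - 4 * (1/2)^k) * dist x y \<le> 7 * dist x y" by (intro mult_right_mono) auto
      then show "\<bar>(\<Sum>j<k. g j x) - (\<Sum>j<k. g j y)\<bar> \<le> 7 * dist x y" using partial[where k=k and x=x and y=y] by linarith
    qed
  qed simp
  \<comment> \<open>Split the series at \<open>k\<close>: the terms before vanish, and those after
    are bounded by \<open>(1/2)^j * t k\<close> with \<open>j > k\<close>, which sum to
    \<open>(1/2)^k * t k\<close>.\<close>
  have u_scale: "\<bar>(u y - u x) - (g k y - g k x)\<bar> \<le> (1/2)^k * dist x y"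
    if x: "x \<in> K" and y: "t k < dist x y" "dist x y < s k" for x y k
  proof -
    define h where "h = (\<lambda>j. g j y - g j x)"
    have h_summ: "summable h" unfolding h_def by (intro summable_diff summ)
    have "u y - u x = (\<Sum>j. h j)" unfolding u_def h_def by (rule suminf_diff[OF summ summ])
    also have "\<dots> = (\<Sum>j. h (j + Suc k)) + (\<Sum>j<Suc k. h j)"
      by (rule suminf_split_initial_segment[OF h_summ])
    also have "(\<Sum>j<Suc k. h j) = h k"
    proof -
      have "h j = 0" if "j < k" for j
        using g_near[OF x, of y j] s_t[OF that] y(2) spos[of k] unfolding h_def by simp
      then show ?thesis by simp
    qed
    finally have eq: "(u y - u x) - (g k y - g k x) = (\<Sum>j. h (j + Suc k))" unfolding h_def by simp
    have bd: "norm (h (j + Suc k)) \<le> (1/2)^j * ((1/2)^(Suc k) * t k)" for j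
    proof -
      have "norm (h (j + Suc k)) \<le> (1/2)^(j + Suc k) * s (j + Suc k)"
        unfolding h_def real_norm_def using g_pow[of "j + Suc k" x] g_pow[of "j + Suc k" y] by linarith
      also have "\<dots> \<le> (1/2)^(j + Suc k) * t k"
        using s_t[of k "j + Suc k"] spos[of "j + Suc k"] by (intro mult_left_mono) auto
      finally show ?thesis by (simp add: power_add)
    qed
    have sums: "(\<lambda>j. (1/2)^j * ((1/2)^(Suc k) * t k)) sums (2 * ((1/2)^(Suc k) * t k))"
      using geometric_sums[of "1/2::real"] by (intro sums_mult2) simp
    have "norm (\<Sum>j. h (j + Suc k)) \<le> (\<Sum>j. (1/2)^j * ((1/2)^(Suc k) * t k))"
      by (rule norm_suminf_le[OF bd sums_summable[OF sums]])
    also have "\<dots> = (1/2)^k * t k" using sums_unique[OF sums] by simp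
    also have "\<dots> \<le> (1/2)^k * dist x y" using y by (intro mult_left_mono) auto
    finally show ?thesis unfolding eq by simp
  qed
  define H where "H = (\<Inter>k. G k)"
  \<comment> \<open>\<open>k > i\<close> brings test \<open>i\<close> into play,
    \<open>s k < d\<close> puts the witness close enough, and \<open>2 * (1/2)^k \<le> d\<close>
    absorbs both the error of \<open>g k\<close> in copying \<open>f\<close> and the tail of the
    series.\<close>
  have deep: "\<exists>k>i. s k < d \<and> 2 * (1/2)^k \<le> d" if d: "0 < d" for i and d :: real
  proof -
    obtain n where n: "(1/2)^n < d / 2" using real_arch_pow_inv[of "d / 2" "1/2"] d by auto
    define k where "k = max n (Suc i)"
    have "(1/2::real)^k \<le> (1/2)^n" unfolding k_def by (intro power_decreasing) auto
    then have "2 * (1/2)^k \<le> d" "s k < d" using n s_pow[of k] d by linarith+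
    then show ?thesis unfolding k_def by (intro exI[of _ k]) (auto simp: k_def)
  qed
  have ck: "c * (1/2)^k * r \<le> (1/2)^k * r" if "0 \<le> r" for k r
    using that c by (intro mult_right_mono) auto
  show ?thesis
  proof (rule that[of H u])
    show "H \<in> sets M" unfolding H_def using G(1) by (intro sets.countable_INT) auto
    show "H \<subseteq> K" unfolding H_def using G(2) by blast
    show "emeasure M (K - H) \<le> ennreal e"
    proof -
      have KM: "K \<in> sets M" unfolding M by (rule borel_compact[OF K(1)])
      have "K - H = (\<Union>k. K - G k)" unfolding H_def by blast
      then have "emeasure M (K - H) \<le> (\<Sum>k. emeasure M (K - G k))"
        using emeasure_subadditive_countably[of "\<lambda>k. K - G k" M] KM G(1) by auto
      also have "\<dots> \<le> (\<Sum>k. ennreal (c * (1/2)^k))"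
        by (intro suminf_le G(3)) auto
      also have "\<dots> = ennreal (\<Sum>k. c * (1/2)^k)"
        using c by (intro suminf_ennreal2) (auto intro: summable_mult summable_geometric)
      also have "(\<Sum>k. c * (1/2)^k) = 2 * c"
        using suminf_geometric[of "1/2::real"] by (simp add: suminf_mult summable_geometric)
      finally show ?thesis using c(3) by (meson ennreal_leI order_trans)
    qed
    fix x i and d :: real
    assume x: "x \<in> H" "recurrent (Q i) x" and d: "0 < d"
    obtain k where k: "i < k" "s k < d" "2 * (1/2)^k \<le> d" using deep[OF d, of i] by blast
    have xk: "x \<in> G k" "x \<in> K" using x(1) G(2) unfolding H_def by blast+
    have dk: "2 * (1/2)^k * dist x y \<le> d * dist x y" for y using k(3) by (intro mult_right_mono) auto
    show "\<exists>y. 0 < dist x y \<and> dist x y < d \<and> Q i x y \<and> \<bar>u y - u x - (f y - f x)\<bar> \<le> d * dist x y"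
    proof -
      obtain y where y: "t k < dist x y" "dist x y < s k" "Q i x y"
        "\<bar>g k y - g k x - (f y - f x)\<bar> \<le> c * (1/2)^k * dist x y" using w1[OF xk(1) k(1) x(2)] by blast
      have "\<bar>u y - u x - (f y - f x)\<bar> \<le> d * dist x y"
        using u_scale[OF xk(2) y(1,2)] y(4) ck[of "dist x y" k] dk[of y] zero_le_dist[of x y] by linarith
      then show ?thesis using y t(1)[of k] k(2) by (intro exI[of _ y]) auto
    qed
    show "\<exists>y. 0 < dist x y \<and> dist x y < d \<and> Q i x y \<and> \<bar>u y - u x\<bar> \<le> d * dist x y"
    proof -
      obtain y where y: "t k < dist x y" "dist x y < s k" "Q i x y" "g k y = g k x"
        using w2[OF xk(1) k(1) x(2)] by blast
      have "0 \<le> (1/2)^k * dist x y" by simp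
      then have "\<bar>u y - u x\<bar> \<le> d * dist x y"
        using u_scale[OF xk(2) y(1,2)] y(4) dk[of y] by linarith
      then show ?thesis using y t(1)[of k] k(2) by (intro exI[of _ y]) auto
    qed
  qed (rule u_lip)
qed

section \<open>Sets of zero length in charts of positive dimension\<close>

lemma has_chart_differential_iff:
  "has_chart_differential n \<phi> u x D \<longleftrightarrow>
     (\<forall>e>0. \<exists>d>0. \<forall>y. 0 < dist x y \<and> dist x y < d \<longrightarrow>
        \<bar>u y - u x - (\<Sum>i<n. D i * (\<phi> y i - \<phi> x i))\<bar> \<le> e * dist x y)" (is "?l \<longleftrightarrow> ?r")
proof
  define q where "q = (\<lambda>y. \<bar>u y - u x - (\<Sum>i<n. D i * (\<phi> y i - \<phi> x i))\<bar>)"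
  have l: "?l \<longleftrightarrow> (\<forall>e>0. eventually (\<lambda>y. ennreal (q y / dist y x) < e) (at x))"
    unfolding has_chart_differential_def q_def
    using Limsup_le_iff[of "at x" "\<lambda>y. ennreal (q y / dist y x)" 0]
    by (simp add: q_def)
  {
    assume ?l
    show ?r
    proof (intro allI impI)
      fix e :: real assume e: "0 < e"
      then have "eventually (\<lambda>y. ennreal (q y / dist y x) < ennreal e) (at x)"
        using l \<open>?l\<close> by simp
      then obtain d where d: "0 < d" "\<And>y. y \<noteq> x \<Longrightarrow> dist y x < d \<Longrightarrow> ennreal (q y / dist y x) < ennreal e"
        unfolding eventually_at by auto
      have "q y \<le> e * dist x y" if "0 < dist x y" "dist x y < d" for y
      proof -
        have "ennreal (q y / dist y x) < ennreal e"
          by (rule d(2)) (use that in \<open>auto simp: dist_commute\<close>)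
        then have "q y / dist y x < e" using e by (simp add: ennreal_less_iff q_def)
        then show ?thesis using that by (simp add: field_simps dist_commute)
      qed
      then show "\<exists>d>0. \<forall>y. 0 < dist x y \<and> dist x y < d \<longrightarrow>
        \<bar>u y - u x - (\<Sum>i<n. D i * (\<phi> y i - \<phi> x i))\<bar> \<le> e * dist x y"
        using d(1) unfolding q_def by blast
    qed
  next
    assume r: ?r
    show ?l unfolding l
    proof (intro allI impI)
      fix e :: ennreal assume "0 < e"
      \<comment> \<open>The intermediate value is finite even for infinite \<open>e\<close> and
        turns the weak bound into a strict one.\<close>
      then obtain e' where "0 < e'" "e' < e" using dense by blast
      then obtain r where er: "e' = ennreal r" "0 < r" by (cases e') auto
      obtain d where d: "0 < d" "\<And>y. 0 < dist x y \<Longrightarrow> dist x y < d \<Longrightarrow> q y \<le> r * dist x y"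
        using r er(2) unfolding q_def by blast
      have "ennreal (q y / dist y x) < e" if "y \<noteq> x" "dist y x < d" for y
      proof -
        have "q y / dist y x \<le> r" using d(2)[of y] that by (simp add: field_simps dist_commute)
        then have "ennreal (q y / dist y x) \<le> e'" unfolding er(1) by (rule ennreal_leI)
        then show ?thesis using \<open>e' < e\<close> by simp
      qed
      then show "eventually (\<lambda>y. ennreal (q y / dist y x) < e) (at x)"
        unfolding eventually_at using d(1) by blast
    qed
  }
qed

lemma chart_coordinate_lipschitz:
  assumes "chart n U \<phi>"
  obtains L where "1 \<le> L" "\<And>i x y. i < n \<Longrightarrow> \<bar>\<phi> x i - \<phi> y i\<bar> \<le> L * dist x y"
proof -
  obtain L where L: "\<And>x y. L2_set (\<lambda>i. \<phi> x i - \<phi> y i) {..<n} \<le> L * dist x y"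
    using assms unfolding chart_def by blast
  have "\<bar>\<phi> x i - \<phi> y i\<bar> \<le> max 1 L * dist x y" if "i < n" for i x y
  proof -
    have "\<bar>\<phi> x i - \<phi> y i\<bar> \<le> L2_set (\<lambda>i. \<bar>\<phi> x i - \<phi> y i\<bar>) {..<n}"
      by (rule member_le_L2_set) (use that in auto)
    also have "\<dots> = L2_set (\<lambda>i. \<phi> x i - \<phi> y i) {..<n}" unfolding L2_set_def by simp
    also have "\<dots> \<le> L * dist x y" by (rule L)
    also have "\<dots> \<le> max 1 L * dist x y" by (intro mult_right_mono) auto
    finally show ?thesis .
  qed
  then show ?thesis using that[of "max 1 L"] by simp
qed

text \<open>This exploits uniqueness of the differential \<open>D\<close>: if the increments of
  \<open>\<phi>\<close> in direction \<open>E\<close> were of smaller order than the distance,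
  \<open>D + E\<close> would be a second differential.\<close>

lemma chart_nondegenerate:
  assumes "chart_differentiable n \<phi> u x" and j: "j < n" "E j \<noteq> 0"
  obtains q where "0 < q" "recurrent (\<lambda>x y. q * dist x y < \<bar>\<Sum>i<n. E i * (\<phi> y i - \<phi> x i)\<bar>) x"
proof -
  obtain D where D: "D \<in> Rn n" "has_chart_differential n \<phi> u x D"
    "\<And>D'. D' \<in> Rn n \<Longrightarrow> has_chart_differential n \<phi> u x D' \<Longrightarrow> D' = D"
    using assms(1) unfolding chart_differentiable_def by blast
  have "\<exists>q>0. recurrent (\<lambda>x y. q * dist x y < \<bar>\<Sum>i<n. E i * (\<phi> y i - \<phi> x i)\<bar>) x"
  proof (rule ccontr)
    assume "\<not> ?thesis"
    then have small: "\<exists>b>0. \<forall>y. 0 < dist x y \<and> dist x y < b \<longrightarrow>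
        \<bar>\<Sum>i<n. E i * (\<phi> y i - \<phi> x i)\<bar> \<le> q * dist x y" if "0 < q" for q
      using that unfolding recurrent_def by (meson not_le_imp_less)
    \<comment> \<open>The value \<open>undefined\<close> from \<open>n\<close> on keeps the vector
      in \<open>Rn n\<close>.\<close>
    define D' where "D' = (\<lambda>i. if i < n then D i + E i else undefined)"
    have "D' \<in> Rn n" unfolding Rn_def D'_def by (simp add: PiE_def extensional_def)
    moreover have "has_chart_differential n \<phi> u x D'"
      unfolding has_chart_differential_iff
    proof (intro allI impI)
      fix e :: real assume e: "0 < e"
      obtain d where d: "0 < d" "\<And>y. 0 < dist x y \<Longrightarrow> dist x y < d \<Longrightarrow>
        \<bar>u y - u x - (\<Sum>i<n. D i * (\<phi> y i - \<phi> x i))\<bar> \<le> e / 2 * dist x y"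
        using D(2)[unfolded has_chart_differential_iff, rule_format, of "e / 2"] e by auto
      obtain b where b: "0 < b" "\<And>y. 0 < dist x y \<Longrightarrow> dist x y < b \<Longrightarrow>
        \<bar>\<Sum>i<n. E i * (\<phi> y i - \<phi> x i)\<bar> \<le> e / 2 * dist x y"
        using small[of "e / 2"] e by auto
      have "\<bar>u y - u x - (\<Sum>i<n. D' i * (\<phi> y i - \<phi> x i))\<bar> \<le> e * dist x y"
        if y: "0 < dist x y" "dist x y < min d b" for y
      proof -
        have "(\<Sum>i<n. D' i * (\<phi> y i - \<phi> x i)) =
            (\<Sum>i<n. D i * (\<phi> y i - \<phi> x i)) + (\<Sum>i<n. E i * (\<phi> y i - \<phi> x i))"
          unfolding D'_def sum.distrib[symmetric] by (intro sum.cong) (auto simp: algebra_simps)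
        moreover have "\<bar>a - (b + c)\<bar> \<le> 2 * t" if "\<bar>a - b\<bar> \<le> t" "\<bar>c\<bar> \<le> t" for a b c t :: real
          using that by linarith
        ultimately show ?thesis using d(2)[of y] b(2)[of y] y by fastforce
      qed
      then show "\<exists>d>0. \<forall>y. 0 < dist x y \<and> dist x y < d \<longrightarrow>
          \<bar>u y - u x - (\<Sum>i<n. D' i * (\<phi> y i - \<phi> x i))\<bar> \<le> e * dist x y"
        using d(1) b(1) by (intro exI[of _ "min d b"]) auto
    qed
    ultimately have "D' = D" by (rule D(3))
    then show False using j unfolding D'_def by (auto dest: fun_cong[of _ _ j])
  qed
  then show ?thesis using that by blast
qed

text \<open>
  Rational directions make the family of tests countable, as \<open>oscillating_function\<close> requires.
\<close>

definition direction_test ::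
    "nat \<Rightarrow> ('a::metric_space \<Rightarrow> nat \<Rightarrow> real) \<Rightarrow> nat \<Rightarrow> 'a \<Rightarrow> 'a \<Rightarrow> bool" where
  "direction_test n \<phi> k x y \<longleftrightarrow> (case from_nat k :: rat list \<times> rat of (D, q) \<Rightarrow>
     of_rat q * dist x y < \<bar>\<Sum>i<n. of_rat (D ! i) * (\<phi> y i - \<phi> x i)\<bar>)"

lemma open_direction_test:
  assumes "chart n U \<phi>" shows "open {x. direction_test n \<phi> k x y}"
proof -
  obtain L where L: "1 \<le> L" "\<And>i x y. i < n \<Longrightarrow> \<bar>\<phi> x i - \<phi> y i\<bar> \<le> L * dist x y"
    using chart_coordinate_lipschitz[OF assms] by blast
  have cont: "continuous_on UNIV (\<lambda>x. \<phi> x i)" if "i < n" for i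
    using L that by (intro lipschitz_on_continuous_on[of L] lipschitz_onI) (auto simp: dist_real_def)
  obtain D q where Dq: "(from_nat k :: rat list \<times> rat) = (D, q)" by force
  show ?thesis unfolding direction_test_def Dq prod.case
    by (intro open_Collect_less continuous_intros cont) auto
qed

text \<open>Replacing \<open>E\<close> and the threshold of \<open>chart_nondegenerate\<close> by
  nearby rational ones gives a test from the countable family that still controls the direction
  \<open>E\<close>.\<close>

lemma rational_direction:
  assumes "chart n U \<phi>" "chart_differentiable n \<phi> u x" and j: "j < n" "E j \<noteq> 0"
  obtains k q where "0 < q" "recurrent (direction_test n \<phi> k) x"
    "\<And>y. direction_test n \<phi> k x y \<Longrightarrow> q * dist x y \<le> \<bar>\<Sum>i<n. E i * (\<phi> y i - \<phi> x i)\<bar>"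
proof -
  obtain L where L: "1 \<le> L" "\<And>i x y. i < n \<Longrightarrow> \<bar>\<phi> x i - \<phi> y i\<bar> \<le> L * dist x y"
    using chart_coordinate_lipschitz[OF assms(1)] by blast
  obtain q where q: "0 < q" "recurrent (\<lambda>x y. q * dist x y < \<bar>\<Sum>i<n. E i * (\<phi> y i - \<phi> x i)\<bar>) x"
    using chart_nondegenerate[where E=E, OF assms(2) j] by blast
  \<comment> \<open>There are \<open>n\<close> coordinates, each \<open>L\<close>-Lipschitz, so the
    two sums differ by at most \<open>q / 4 * dist x y\<close>.\<close>
  define \<delta> where "\<delta> = q / (4 * L * n)"
  have \<delta>: "0 < \<delta>" unfolding \<delta>_def using q L j by simp
  have "\<exists>r::rat. E i < of_rat r \<and> of_rat r < E i + \<delta>" for i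
    using of_rat_dense[of "E i" "E i + \<delta>"] \<delta> by simp
  then obtain r :: "nat \<Rightarrow> rat" where r: "\<And>i. E i < of_rat (r i) \<and> of_rat (r i) < E i + \<delta>" by metis
  \<comment> \<open>This range leaves the error \<open>q / 4\<close> on both sides: below
    \<open>q\<close> for the recurrence, above \<open>q / 4\<close> for the final lower
    bound.\<close>
  obtain q' :: rat where q': "q / 2 < of_rat q'" "of_rat q' < 3 * q / 4"
    using of_rat_dense[of "q / 2" "3 * q / 4"] q(1) by auto
  define k where "k = to_nat (map r [0..<n], q')"
  have test: "direction_test n \<phi> k x y \<longleftrightarrow> of_rat q' * dist x y < \<bar>\<Sum>i<n. of_rat (r i) * (\<phi> y i - \<phi> x i)\<bar>" for y
    unfolding direction_test_def k_def by simp
  have close: "\<bar>(\<Sum>i<n. of_rat (r i) * (\<phi> y i - \<phi> x i)) - (\<Sum>i<n. E i * (\<phi> y i - \<phi> x i))\<bar> \<le> q / 4 * dist x y" for y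
  proof -
    have "(\<Sum>i<n. of_rat (r i) * (\<phi> y i - \<phi> x i)) - (\<Sum>i<n. E i * (\<phi> y i - \<phi> x i)) =
        (\<Sum>i<n. (of_rat (r i) - E i) * (\<phi> y i - \<phi> x i))"
      by (simp add: sum_subtractf left_diff_distrib)
    also have "\<bar>\<dots>\<bar> \<le> (\<Sum>i<n. \<delta> * (L * dist x y))"
    proof (rule order_trans[OF sum_abs sum_mono])
      fix i assume "i \<in> {..<n}"
      then have "\<bar>\<phi> y i - \<phi> x i\<bar> \<le> L * dist x y" using L(2)[of i y x] by (simp add: dist_commute)
      then show "\<bar>(of_rat (r i) - E i) * (\<phi> y i - \<phi> x i)\<bar> \<le> \<delta> * (L * dist x y)"
        unfolding abs_mult using r[of i] \<delta> by (intro mult_mono) auto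
    qed
    also have "\<dots> = q / 4 * dist x y" unfolding \<delta>_def using L(1) j by simp
    finally show ?thesis .
  qed
  show ?thesis
  proof (rule that[of "q / 4" k])
    show "recurrent (direction_test n \<phi> k) x" unfolding recurrent_def
    proof (intro allI impI)
      fix b :: real assume "0 < b"
      then obtain y where y: "0 < dist x y" "dist x y < b" "q * dist x y < \<bar>\<Sum>i<n. E i * (\<phi> y i - \<phi> x i)\<bar>"
        using q(2) unfolding recurrent_def by blast
      have "of_rat q' * dist x y \<le> 3 * q / 4 * dist x y" using q' by (intro mult_right_mono) auto
      then have "direction_test n \<phi> k x y" unfolding test using close[of y] y(3) by linarith
      then show "\<exists>y. 0 < dist x y \<and> dist x y < b \<and> direction_test n \<phi> k x y" using y by blast
    qed
    show "q / 4 * dist x y \<le> \<bar>\<Sum>i<n. E i * (\<phi> y i - \<phi> x i)\<bar>" if "direction_test n \<phi> k x y" for y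
    proof -
      have "q / 2 * dist x y \<le> of_rat q' * dist x y" using q' by (intro mult_right_mono) auto
      then show ?thesis using that close[of y] unfolding test by linarith
    qed
  qed (use q in simp)
qed

text \<open>The oscillating function is built from \<open>f\<close>, the first coordinate rescaled
  to be 1-Lipschitz. Comparing its differential \<open>D\<close> with an expected one
  \<open>D'\<close> only needs scales at which the direction \<open>E = D - D'\<close> is not
  degenerate; the tests select these, and they recur at every point of differentiability.\<close>

lemma null_length_in_chart:
  fixes M :: "'a::metric_space measure"
  assumes M: "sets M = sets borel" and U: "chart n U \<phi>" "0 < n"
    and diff: "\<And>u. u \<in> Lip \<Longrightarrow> AE x in M. x \<in> U \<longrightarrow> chart_differentiable n \<phi> u x"
    and K: "K \<subseteq> U" "compact K" "null_length K" "emeasure M K < \<infinity>"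
  shows "emeasure M K = 0"
proof (rule ccontr)
  assume pos: "emeasure M K \<noteq> 0"
  then have ne: "K \<noteq> {}" by auto
  obtain m where m: "emeasure M K = ennreal m" "0 < m"
    using K(4) pos by (cases "emeasure M K") (auto simp: order_less_le)
  obtain L where L: "1 \<le> L" "\<And>i x y. i < n \<Longrightarrow> \<bar>\<phi> x i - \<phi> y i\<bar> \<le> L * dist x y"
    using chart_coordinate_lipschitz[OF U(1)] by blast
  define f where "f = (\<lambda>x. \<phi> x 0 / L)"
  have f: "\<bar>f x - f y\<bar> \<le> dist x y" for x y
    using L(1) L(2)[OF U(2), of x y] unfolding f_def
    by (simp add: field_simps flip: diff_divide_distrib)
  obtain u G where G: "G \<in> sets M" "G \<subseteq> K" "emeasure M (K - G) \<le> ennreal (m / 2)"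
    and u: "\<And>x y. \<bar>u x - u y\<bar> \<le> 7 * dist x y"
    and w1: "\<And>x i d. x \<in> G \<Longrightarrow> recurrent (direction_test n \<phi> i) x \<Longrightarrow> 0 < d \<Longrightarrow>
       \<exists>y. 0 < dist x y \<and> dist x y < d \<and> direction_test n \<phi> i x y \<and> \<bar>u y - u x - (f y - f x)\<bar> \<le> d * dist x y"
    and w2: "\<And>x i d. x \<in> G \<Longrightarrow> recurrent (direction_test n \<phi> i) x \<Longrightarrow> 0 < d \<Longrightarrow>
       \<exists>y. 0 < dist x y \<and> dist x y < d \<and> direction_test n \<phi> i x y \<and> \<bar>u y - u x\<bar> \<le> d * dist x y"
    by (rule oscillating_function[where Q="direction_test n \<phi>",
          OF M K(2) ne K(3,4) f open_direction_test[OF U(1)] half_gt_zero[OF m(2)]]) (rule that)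
  have "u \<in> Lip" unfolding Lip_def
    by (auto intro!: exI[of _ 7] lipschitz_onI u simp: dist_real_def)
  then have "AE x in M. x \<in> U \<longrightarrow> chart_differentiable n \<phi> u x" by (rule diff)
  then obtain Z where Z: "{x \<in> space M. \<not> (x \<in> U \<longrightarrow> chart_differentiable n \<phi> u x)} \<subseteq> Z"
    "emeasure M Z = 0" "Z \<in> sets M" by (rule AE_E)
  \<comment> \<open>At most half of the measure of \<open>K\<close> is lost, so \<open>G\<close> is
    not null and contains a point of differentiability.\<close>
  have "\<not> G \<subseteq> Z"
  proof
    assume "G \<subseteq> Z"
    then have "emeasure M G = 0" using Z(2,3) emeasure_mono[of G Z M] by simp
    moreover have "emeasure M K \<le> emeasure M (K - G) + emeasure M G"
      using emeasure_subadditive[of "K - G" M G] G(1,2) borel_compact[OF K(2)] M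
      by (simp add: Un_absorb2)
    ultimately have "ennreal m \<le> ennreal (m / 2)" using G(3) m(1) by simp
    then show False using m(2) by simp
  qed
  then obtain x where x: "x \<in> G" "x \<notin> Z" by blast
  have "space M = UNIV" using sets_eq_imp_space_eq[OF M] by simp
  then have cd: "chart_differentiable n \<phi> u x" using x G(2) K(1) Z(1) by auto
  then obtain D where D: "has_chart_differential n \<phi> u x D"
    unfolding chart_differentiable_def by blast
  \<comment> \<open>Scales where \<open>u\<close> is constant force \<open>D = 0\<close>; scales where \<open>u\<close> copies \<open>f\<close> force \<open>D = e\<^sub>0 / L\<close>.\<close>
  have D0: "D i = 0" if i: "i < n" for i
  proof (rule ccontr)
    assume "D i \<noteq> 0"
    then obtain k q where k: "0 < q" "recurrent (direction_test n \<phi> k) x"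
      "\<And>y. direction_test n \<phi> k x y \<Longrightarrow> q * dist x y \<le> \<bar>\<Sum>i<n. D i * (\<phi> y i - \<phi> x i)\<bar>"
      using rational_direction[where E=D, OF U(1) cd i] by blast
    obtain d where d: "0 < d" "\<And>y. 0 < dist x y \<Longrightarrow> dist x y < d \<Longrightarrow>
        \<bar>u y - u x - (\<Sum>i<n. D i * (\<phi> y i - \<phi> x i))\<bar> \<le> q / 4 * dist x y"
      using D[unfolded has_chart_differential_iff, rule_format, of "q / 4"] k(1) by auto
    \<comment> \<open>Here the increment of \<open>u\<close> and the remainder of the differential
      are each at most \<open>q / 4 * dist x y\<close>, while the test makes the increment along
      \<open>D\<close> at least \<open>q * dist x y\<close>.\<close>
    obtain y where y: "0 < dist x y" "dist x y < min d (q / 4)" "direction_test n \<phi> k x y"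
      "\<bar>u y - u x\<bar> \<le> min d (q / 4) * dist x y"
      using w2[OF x(1) k(2), of "min d (q / 4)"] d(1) k(1) by auto
    have "min d (q / 4) * dist x y \<le> q / 4 * dist x y" by (intro mult_right_mono) auto
    then have "q * dist x y \<le> q / 2 * dist x y" using k(3)[OF y(3)] d(2)[OF y(1)] y(2,4) by linarith
    then show False using y(1) k(1) by simp
  qed
  \<comment> \<open>The difference between \<open>D\<close> and the coefficient vector of
    \<open>f\<close>.\<close>
  define E where "E = (\<lambda>i. D i - (if i = 0 then 1 / L else 0))"
  have "E 0 \<noteq> 0" unfolding E_def using D0[OF U(2)] L(1) by simp
  then obtain k q where k: "0 < q" "recurrent (direction_test n \<phi> k) x"
    "\<And>y. direction_test n \<phi> k x y \<Longrightarrow> q * dist x y \<le> \<bar>\<Sum>i<n. E i * (\<phi> y i - \<phi> x i)\<bar>"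
    using rational_direction[where E=E, OF U(1) cd U(2)] by blast
  obtain d where d: "0 < d" "\<And>y. 0 < dist x y \<Longrightarrow> dist x y < d \<Longrightarrow>
      \<bar>u y - u x - (\<Sum>i<n. D i * (\<phi> y i - \<phi> x i))\<bar> \<le> q / 4 * dist x y"
    using D[unfolded has_chart_differential_iff, rule_format, of "q / 4"] k(1) by auto
  obtain y where y: "0 < dist x y" "dist x y < min d (q / 4)" "direction_test n \<phi> k x y"
    "\<bar>u y - u x - (f y - f x)\<bar> \<le> min d (q / 4) * dist x y"
    using w1[OF x(1) k(2), of "min d (q / 4)"] d(1) k(1) by auto
  have "(\<Sum>i<n. (if i = 0 then 1 / L else 0) * (\<phi> y i - \<phi> x i)) = f y - f x"
  proof -
    have "(\<Sum>i<n. (if i = 0 then 1 / L else 0) * (\<phi> y i - \<phi> x i)) =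
        (\<Sum>i<n. if i = 0 then (\<phi> y 0 - \<phi> x 0) / L else 0)" by (intro sum.cong) auto
    also have "\<dots> = f y - f x" using U(2) by (simp add: f_def diff_divide_distrib)
    finally show ?thesis .
  qed
  then have "(\<Sum>i<n. E i * (\<phi> y i - \<phi> x i)) = (\<Sum>i<n. D i * (\<phi> y i - \<phi> x i)) - (f y - f x)"
    unfolding E_def by (simp add: left_diff_distrib sum_subtractf)
  moreover have "min d (q / 4) * dist x y \<le> q / 4 * dist x y" by (intro mult_right_mono) auto
  ultimately have "q * dist x y \<le> q / 2 * dist x y" using k(3)[OF y(3)] d(2)[OF y(1)] y(2,4) by linarith
  then show False using y(1) k(1) by simp
qed

section \<open>Sets of positive upper density\<close>

text \<open>Greedy choice: a ball of largest radius is kept, the balls meeting it lie in its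
  threefold enlargement, and the rest is treated by induction. Balls of nonpositive radius are
  empty.\<close>

lemma finite_vitali:
  fixes a :: "'i \<Rightarrow> 'a::metric_space" and r :: "'i \<Rightarrow> real"
  assumes "finite I"
  shows "\<exists>J\<subseteq>I. disjoint_family_on (\<lambda>i. ball (a i) (r i)) J \<and>
           (\<Union>i\<in>I. ball (a i) (r i)) \<subseteq> (\<Union>i\<in>J. ball (a i) (3 * r i))"
  using assms
proof (induction I rule: finite_psubset_induct)
  case (psubset I)
  show ?case
  proof (cases "\<exists>i\<in>I. 0 < r i")
    case False
    then have "(\<Union>i\<in>I. ball (a i) (r i)) = {}" by (auto simp: not_less intro: ball_empty)
    then show ?thesis by (intro exI[of _ "{}"]) (auto simp: disjoint_family_on_def)
  next
    case True
    then have "I \<noteq> {}" by blast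
    obtain m where m: "m \<in> I" "\<And>i. i \<in> I \<Longrightarrow> r i \<le> r m"
      using Max_in[of "r ` I"] Max_ge[of "r ` I"] psubset.hyps \<open>I \<noteq> {}\<close> by fastforce
    have rm: "0 < r m" using True m by force
    define I' where "I' = {i \<in> I. ball (a i) (r i) \<inter> ball (a m) (r m) = {}}"
    have "m \<notin> I'" unfolding I'_def using rm by auto
    then have "I' \<subset> I" using m(1) unfolding I'_def by blast
    from psubset.IH[OF this] obtain J where J: "J \<subseteq> I'" "disjoint_family_on (\<lambda>i. ball (a i) (r i)) J"
      "(\<Union>i\<in>I'. ball (a i) (r i)) \<subseteq> (\<Union>i\<in>J. ball (a i) (3 * r i))" by blast
    have cover: "ball (a i) (r i) \<subseteq> ball (a m) (3 * r m)" if i: "i \<in> I" "i \<notin> I'" for i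
    proof
      fix y assume y: "y \<in> ball (a i) (r i)"
      obtain z where z: "z \<in> ball (a i) (r i)" "z \<in> ball (a m) (r m)" using i unfolding I'_def by blast
      have "dist (a m) y \<le> dist (a m) z + dist (a i) z + dist (a i) y"
        using dist_triangle[of "a m" y z] dist_triangle3[of z y "a i"] by simp
      then show "y \<in> ball (a m) (3 * r m)" using y z m(2)[OF i(1)] by simp
    qed
    show ?thesis
    proof (intro exI[of _ "insert m J"] conjI)
      show "insert m J \<subseteq> I" using m(1) J(1) unfolding I'_def by blast
      show "disjoint_family_on (\<lambda>i. ball (a i) (r i)) (insert m J)"
        using J(1,2) \<open>m \<notin> I'\<close> unfolding disjoint_family_on_def I'_def by blast
      show "(\<Union>i\<in>I. ball (a i) (r i)) \<subseteq> (\<Union>i\<in>insert m J. ball (a i) (3 * r i))"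
        using cover J(3) by blast
    qed
  qed
qed

text \<open>This lies between the sets where the upper \<open>N\<close>-density is greater than
  \<open>c\<close> and where it is at least \<open>c\<close>. The strict inequality is an open
  condition on \<open>x\<close>, which makes the set a G-delta.\<close>

definition upper_density_above :: "'a::metric_space measure \<Rightarrow> real \<Rightarrow> real \<Rightarrow> 'a set" where
  "upper_density_above M N c =
     {x. \<forall>d>0. \<exists>r>0. r < d \<and> ennreal (c * r powr N) < emeasure M (ball x r)}"

text \<open>For a ball with \<open>c * r powr N < emeasure M (ball x r)\<close>, the radius
  \<open>r = r powr (1 - N) * r powr N\<close> is a small multiple of the measure once
  \<open>r\<close> is small, because \<open>N < 1\<close>. Disjoint balls near \<open>K\<close> have
  bounded total measure, so by the Vitali covering the radii have a small sum.\<close>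

lemma upper_density_above_null_length:
  fixes M :: "'a::metric_space measure"
  assumes M: "sets M = sets borel" and fin: "\<And>U. open U \<Longrightarrow> bounded U \<Longrightarrow> emeasure M U < \<infinity>"
    and N: "N < 1" and c: "0 < c"
    and K: "compact K" "K \<subseteq> upper_density_above M N c"
  shows "null_length K"
  unfolding null_length_def
proof (intro allI impI)
  fix e :: real assume e: "0 < e"
  \<comment> \<open>All balls used below lie in this bounded neighbourhood, since their radii are
    less than \<open>\<rho> \<le> 1\<close>.\<close>
  define V where "V = (\<Union>x\<in>K. ball x 1)"
  obtain z R where "K \<subseteq> cball z R" using compact_imp_bounded[OF K(1)] bounded_subset_cball by blast
  then have "V \<subseteq> ball z (R + 1)"
  proof -
    have "dist z y < R + 1" if "x \<in> K" "dist x y < 1" for x y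
      using \<open>K \<subseteq> cball z R\<close> that dist_triangle[of z y x] by force
    then show ?thesis unfolding V_def by auto
  qed
  then have "bounded V" using bounded_subset bounded_ball by blast
  moreover have V_open: "open V" unfolding V_def by blast
  ultimately have Vfin: "emeasure M V < \<infinity>" using fin by blast
  define m where "m = measure M V"
  have m0: "0 \<le> m" unfolding m_def by simp
  \<comment> \<open>The factor 3 comes from the enlarged balls; \<open>m + 1\<close> avoids division
    by zero.\<close>
  define w where "w = e * c / (3 * (m + 1))"
  have w: "0 < w" using e c m0 unfolding w_def by simp
  have wm: "3 * w / c * m < e"
  proof -
    have "3 * w / c * m = e * (m / (m + 1))" using c m0 unfolding w_def by (simp add: divide_simps)
    also have "\<dots> < e * 1" using e m0 by (intro mult_strict_left_mono) auto
    finally show ?thesis by simp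
  qed
  define \<rho> where "\<rho> = min 1 (w powr (1 / (1 - N)))"
  have \<rho>: "0 < \<rho>" "\<rho> \<le> 1" using w unfolding \<rho>_def by auto
  have \<rho>w: "\<rho> powr (1 - N) \<le> w"
  proof -
    have "\<rho> powr (1 - N) \<le> (w powr (1 / (1 - N))) powr (1 - N)"
      using \<rho> N unfolding \<rho>_def by (intro powr_mono2) auto
    then show ?thesis using N w by (simp add: powr_powr)
  qed
  have "\<forall>x\<in>K. \<exists>r>0. r < \<rho> \<and> ennreal (c * r powr N) < emeasure M (ball x r)"
    using K(2) \<rho>(1) unfolding upper_density_above_def by blast
  then obtain r where r: "\<And>x. x \<in> K \<Longrightarrow> 0 < r x" "\<And>x. x \<in> K \<Longrightarrow> r x < \<rho>"
    "\<And>x. x \<in> K \<Longrightarrow> ennreal (c * r x powr N) < emeasure M (ball x (r x))" by metis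
  obtain I where I: "I \<subseteq> K" "finite I" "K \<subseteq> (\<Union>x\<in>I. ball x (r x))"
    by (rule compactE_image[OF K(1), of K "\<lambda>x. ball x (r x)"]) (use r(1) in auto)
  obtain J where J: "J \<subseteq> I" "disjoint_family_on (\<lambda>x. ball x (r x)) J"
    "(\<Union>x\<in>I. ball x (r x)) \<subseteq> (\<Union>x\<in>J. ball x (3 * r x))"
    using finite_vitali[OF I(2), of "\<lambda>x. x" r] by blast
  have JK: "J \<subseteq> K" "finite J" using J(1) I finite_subset by auto
  have sub: "ball x (r x) \<subseteq> V" if "x \<in> K" for x
    unfolding V_def using that r(2)[OF that] \<rho>(2) by force
  have Vs: "V \<in> sets M" using M V_open by simp
  have ball_fin: "emeasure M (ball x (r x)) < \<infinity>" if "x \<in> K" for x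
    using emeasure_mono[OF sub[OF that] Vs] Vfin by (metis order_le_less_trans)
  have each: "r x \<le> w / c * measure M (ball x (r x))" if x: "x \<in> K" for x
  proof -
    have "r x = r x powr (1 - N) * r x powr N"
      using r(1)[OF x] by (simp flip: powr_add)
    also have "\<dots> \<le> \<rho> powr (1 - N) * r x powr N"
      using r(1,2)[OF x] N by (intro mult_right_mono powr_mono2) auto
    also have "\<dots> \<le> w * r x powr N" by (intro mult_right_mono \<rho>w) auto
    also have "\<dots> = w / c * (c * r x powr N)" using c by simp
    also have "\<dots> \<le> w / c * measure M (ball x (r x))"
    proof (rule mult_left_mono)
      have "ennreal (c * r x powr N) < ennreal (measure M (ball x (r x)))"
        using r(3)[OF x] ball_fin[OF x] by (simp add: emeasure_eq_ennreal_measure)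
      then show "c * r x powr N \<le> measure M (ball x (r x))"
        using c by (simp add: ennreal_less_iff)
    qed (use w c in auto)
    finally show ?thesis .
  qed
  have "(\<Sum>x\<in>J. 3 * r x) \<le> (\<Sum>x\<in>J. 3 * w / c * measure M (ball x (r x)))"
    using each JK(1) by (intro sum_mono) (force simp: mult.assoc)
  also have "\<dots> = 3 * w / c * (\<Sum>x\<in>J. measure M (ball x (r x)))" by (simp add: sum_distrib_left)
  also have "(\<Sum>x\<in>J. measure M (ball x (r x))) = measure M (\<Union>x\<in>J. ball x (r x))"
    using JK J(2) ball_fin M by (intro measure_finite_Union[symmetric]) (auto simp: order_less_le)
  also have "3 * w / c * measure M (\<Union>x\<in>J. ball x (r x)) \<le> 3 * w / c * m"
    unfolding m_def using w c sub JK Vs Vfin M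
    by (intro mult_left_mono measure_mono_fmeasurable) (auto simp: fmeasurable_def)
  also have "\<dots> < e" by (rule wm)
  finally have small: "(\<Sum>x\<in>J. 3 * r x) < e" .
  define F where "F = (\<lambda>x. (x, 3 * r x)) ` J"
  have "(\<Sum>(x, r)\<in>F. r) = (\<Sum>x\<in>J. 3 * r x)"
    unfolding F_def by (subst sum.reindex) (auto simp: inj_on_def)
  then show "\<exists>F. finite F \<and> (\<forall>(x, r)\<in>F. 0 < r) \<and> K \<subseteq> (\<Union>(x, r)\<in>F. ball x r) \<and> (\<Sum>(x, r)\<in>F. r) < e"
    using small JK r(1) I(3) J(3) by (intro exI[of _ F]) (auto simp: F_def)
qed

section \<open>Measurability and nullity of the sets of positive upper density\<close>

text \<open>Lower semicontinuity: by continuity from below, a slightly smaller concentric ball still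
  has measure above \<open>a\<close>, and it is contained in \<open>ball y r\<close> for all
  \<open>y\<close> near \<open>x\<close>.\<close>

lemma open_emeasure_ball_greater:
  fixes M :: "'a::metric_space measure"
  assumes M: "sets M = sets borel"
  shows "open {x. a < emeasure M (ball x r)}"
  unfolding open_dist
proof (intro ballI)
  fix x assume "x \<in> {x. a < emeasure M (ball x r)}"
  then have x: "a < emeasure M (ball x r)" by simp
  define B where "B = (\<lambda>k::nat. ball x (r - 1 / (real k + 1)))"
  have "incseq B" unfolding B_def incseq_def
    by (auto intro!: subset_ball divide_left_mono)
  moreover have "(\<Union>k. B k) = ball x r"
  proof
    show "ball x r \<subseteq> (\<Union>k. B k)"
    proof
      fix y assume "y \<in> ball x r"
      then have "0 < r - dist x y" by simp
      then obtain k where "inverse (real (Suc k)) < r - dist x y" using reals_Archimedean by blast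
      then have "y \<in> B k" unfolding B_def by (simp add: inverse_eq_divide algebra_simps)
      then show "y \<in> (\<Union>k. B k)" by blast
    qed
    show "(\<Union>k. B k) \<subseteq> ball x r"
    proof
      fix y assume "y \<in> (\<Union>k. B k)"
      then obtain k where "dist x y < r - 1 / (real k + 1)" unfolding B_def by auto
      moreover have "0 < 1 / (real k + 1)" by simp
      ultimately have "dist x y < r" by linarith
      then show "y \<in> ball x r" by simp
    qed
  qed
  ultimately have "(SUP k. emeasure M (B k)) = emeasure M (ball x r)"
    using SUP_emeasure_incseq[of B M] M unfolding B_def by (auto simp: image_subset_iff)
  then obtain k where k: "a < emeasure M (B k)" using x less_SUP_iff by metis
  have "a < emeasure M (ball y r)" if "dist y x < 1 / (real k + 1)" for y
  proof -
    have "B k \<subseteq> ball y r"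
    proof
      fix z assume "z \<in> B k"
      then show "z \<in> ball y r" using that dist_triangle[of y z x] unfolding B_def by simp
    qed
    then have "emeasure M (B k) \<le> emeasure M (ball y r)" by (rule emeasure_mono) (simp add: M)
    then show ?thesis using k by simp
  qed
  then show "\<exists>e>0. \<forall>y. dist y x < e \<longrightarrow> y \<in> {x. a < emeasure M (ball x r)}"
    by (intro exI[of _ "1 / (real k + 1)"]) simp
qed

lemma upper_density_above_measurable:
  fixes M :: "'a::metric_space measure"
  assumes M: "sets M = sets borel"
  shows "upper_density_above M N c \<in> sets M"
proof -
  define W where "W = (\<lambda>k::nat. \<Union>r\<in>{0<..<1 / (real k + 1)}. {x. ennreal (c * r powr N) < emeasure M (ball x r)})"
  have "upper_density_above M N c = (\<Inter>k. W k)"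
  proof (intro set_eqI iffI)
    fix x assume x: "x \<in> upper_density_above M N c"
    have "x \<in> W k" for k
    proof -
      have "0 < 1 / (real k + 1)" by simp
      with x obtain r where "0 < r" "r < 1 / (real k + 1)" "ennreal (c * r powr N) < emeasure M (ball x r)"
        unfolding upper_density_above_def by blast
      then show ?thesis unfolding W_def by auto
    qed
    then show "x \<in> (\<Inter>k. W k)" by blast
  next
    fix x assume x: "x \<in> (\<Inter>k. W k)"
    show "x \<in> upper_density_above M N c" unfolding upper_density_above_def mem_Collect_eq
    proof (intro allI impI)
      fix d :: real assume "0 < d"
      then obtain k where k: "inverse (real (Suc k)) < d" using reals_Archimedean by blast
      have "x \<in> W k" using x by blast
      then obtain r where "0 < r" "r < 1 / (real k + 1)" "ennreal (c * r powr N) < emeasure M (ball x r)"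
        unfolding W_def by auto
      moreover have "1 / (real k + 1) < d" using k by (simp add: inverse_eq_divide add.commute)
      ultimately show "\<exists>r>0. r < d \<and> ennreal (c * r powr N) < emeasure M (ball x r)"
        by (intro exI[of _ r]) auto
    qed
  qed
  moreover have "W k \<in> sets M" for k
    unfolding W_def M by (intro borel_open open_UN ballI open_emeasure_ball_greater[OF M])
  ultimately show ?thesis by (simp add: sets.countable_INT)
qed

lemma emeasure_open_bounded_finite:
  assumes "metric_measure_space M" "open V" "bounded V"
  shows "emeasure M V < \<infinity>"
proof (cases "V = {}")
  case False
  then show ?thesis using assms unfolding metric_measure_space_def by blast
qed simp

text \<open>Inner regularity reduces this to compact subsets, which have zero length by the covering
  argument and hence measure zero in the chart.\<close>

lemma upper_density_above_null_in_chart: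
  fixes M :: "'a::polish_space measure"
  assumes M: "metric_measure_space M" and U: "chart n U \<phi>" "0 < n"
    and diff: "\<And>u. u \<in> Lip \<Longrightarrow> AE x in M. x \<in> U \<longrightarrow> chart_differentiable n \<phi> u x"
    and N: "N < 1" and c: "0 < c"
  shows "emeasure M (upper_density_above M N c \<inter> U) = 0"
proof -
  have sets: "sets M = sets borel" and reg: "\<And>A. A \<in> sets M \<Longrightarrow>
      emeasure M A = (SUP K\<in>{K. compact K \<and> K \<subseteq> A}. emeasure M K)"
    using M unfolding metric_measure_space_def radon_measure_def by blast+
  note fin = emeasure_open_bounded_finite[OF M]
  have "U \<in> sets M" using U(1) sets unfolding chart_def by simp
  then have "upper_density_above M N c \<inter> U \<in> sets M"
    using upper_density_above_measurable[OF sets] by blast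
  then have "emeasure M (upper_density_above M N c \<inter> U) =
      (SUP K\<in>{K. compact K \<and> K \<subseteq> upper_density_above M N c \<inter> U}. emeasure M K)" by (rule reg)
  also have "\<dots> \<le> 0"
  proof (rule SUP_least)
    fix K assume "K \<in> {K. compact K \<and> K \<subseteq> upper_density_above M N c \<inter> U}"
    then have K: "compact K" "K \<subseteq> upper_density_above M N c" "K \<subseteq> U" by auto
    obtain z R where R: "K \<subseteq> ball z R"
      using compact_imp_bounded[OF K(1)] bounded_subset_ballD by blast
    then have "emeasure M K \<le> emeasure M (ball z R)" by (rule emeasure_mono) (simp add: sets)
    also have "\<dots> < \<infinity>" by (rule fin) auto
    finally have Kfin: "emeasure M K < \<infinity>" .
    have "null_length K" by (rule upper_density_above_null_length[OF sets fin N c K(1,2)])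
    with null_length_in_chart[OF sets U diff K(3,1)] Kfin have "emeasure M K = 0" by blast
    then show "emeasure M K \<le> 0" by simp
  qed
  finally show ?thesis by simp
qed

section \<open>Slices of the superlevel set\<close>

lemma Theta_bound:
  assumes "0 < r" "r \<le> r\<^sub>0"
  shows "emeasure M (ball x r) \<le> Theta M N r\<^sub>0 x * ennreal (r powr N)"
proof -
  have pos: "0 < ennreal (r powr N)" using assms by simp
  have "emeasure M (ball x r) / ennreal (r powr N) \<le> Theta M N r\<^sub>0 x"
    unfolding Theta_def using assms by (intro SUP_upper) auto
  then have "emeasure M (ball x r) / ennreal (r powr N) * ennreal (r powr N) \<le> Theta M N r\<^sub>0 x * ennreal (r powr N)"
    by (intro mult_right_mono) auto
  moreover have "emeasure M (ball x r) / ennreal (r powr N) * ennreal (r powr N) = emeasure M (ball x r)"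
    using pos by (metis ennreal_less_top ennreal_times_divide ennreal_zero_less_divide less_irrefl mult.commute mult_divide_eq_ennreal)
  ultimately show ?thesis by simp
qed

lemma powr_le_divide:
  fixes d :: real
  assumes "0 < d" "0 < l" "l * d powr (a + 1) \<le> b * d"
  shows "d powr a \<le> b / l"
proof -
  have eq: "l * d powr (a + 1) = (l * d powr a) * d" using assms(1) by (simp add: powr_add)
  have "l * d powr a \<le> b" using assms(1,3) unfolding eq by (rule mult_right_le_imp_le[rotated])
  then show ?thesis using assms(2) by (simp add: pos_le_divide_eq mult.commute)
qed

text \<open>The global slope \<open>L\<close> first confines the slice to distance \<open>d\<close>,
  where the possibly better slope \<open>k\<close> applies and confines it to a ball of radius
  \<open>2 * (k / l) powr (p / N)\<close>. The \<open>N\<close>-th power of this radius contains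
  \<open>(k / l) powr p\<close>, which cancels \<open>l powr p\<close>.\<close>

lemma slice_bound:
  fixes M :: "'a::metric_space measure" and u :: "'a \<Rightarrow> real" and c :: ennreal
  assumes M: "sets M = sets borel" and p: "1 \<le> p" and N: "0 < N"
    and L: "0 < L" "\<And>y. \<bar>u x - u y\<bar> \<le> L * dist x y"
    and l: "0 < l" "(L / l) powr (p / N) < d"
    and k: "0 < k" "\<And>y. dist x y < d \<Longrightarrow> \<bar>u x - u y\<bar> \<le> k * dist x y"
    and r: "2 * (k / l) powr (p / N) \<le> r" "\<And>s. 0 < s \<Longrightarrow> s \<le> r \<Longrightarrow> emeasure M (ball x s) \<le> c * ennreal (s powr N)"
  shows "ennreal (l powr p) * emeasure M (Pair x -` E_set p N l u) \<le> ennreal (2 powr N * k powr p) * c"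
proof -
  have key: "dist x y \<le> (b / l) powr (p / N)"
    if "x \<noteq> y" "l * dist x y powr (N / p + 1) \<le> \<bar>u x - u y\<bar>" "\<bar>u x - u y\<bar> \<le> b * dist x y" for b y
  proof -
    have d: "0 < dist x y" using that by simp
    have "dist x y powr (N / p) \<le> b / l"
      by (rule powr_le_divide[OF d l(1)]) (use that in linarith)
    then have "(dist x y powr (N / p)) powr (p / N) \<le> (b / l) powr (p / N)"
      using p N by (intro powr_mono2) auto
    then show ?thesis using p N d by (simp add: powr_powr)
  qed
  define s where "s = (k / l) powr (p / N)"
  have s: "0 < s" unfolding s_def using k(1) l(1) by simp
  \<comment> \<open>Doubling \<open>s\<close> turns the bound \<open>dist x y \<le> s\<close> into
    membership in an open ball; this is the origin of \<open>2 powr N\<close>.\<close>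
  have "Pair x -` E_set p N l u \<subseteq> ball x (2 * s)"
  proof
    fix y assume "y \<in> Pair x -` E_set p N l u"
    then have y: "x \<noteq> y" "l * dist x y powr (N / p + 1) \<le> \<bar>u x - u y\<bar>" unfolding E_set_def by auto
    have "dist x y < d" using key[OF y L(2)] l(2) by simp
    then have "dist x y \<le> s" unfolding s_def using key[OF y k(2)] by simp
    then show "y \<in> ball x (2 * s)" using s by simp
  qed
  then have "emeasure M (Pair x -` E_set p N l u) \<le> emeasure M (ball x (2 * s))"
    by (rule emeasure_mono) (simp add: M)
  also have "\<dots> \<le> c * ennreal ((2 * s) powr N)" using s r unfolding s_def by auto
  also have "(2 * s) powr N = 2 powr N * (k / l) powr p"
    unfolding s_def using N by (simp add: powr_mult powr_powr)
  finally have "ennreal (l powr p) * emeasure M (Pair x -` E_set p N l u)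
      \<le> ennreal (l powr p) * (c * ennreal (2 powr N * (k / l) powr p))" by (intro mult_left_mono) auto
  also have "\<dots> = ennreal (l powr p * (2 powr N * (k / l) powr p)) * c"
    by (simp add: ennreal_mult ac_simps)
  also have "l powr p * (2 powr N * (k / l) powr p) = 2 powr N * k powr p"
    using l(1) k(1) by (simp add: powr_divide)
  finally show ?thesis .
qed

lemma eventually_divide_powr_less:
  fixes a :: real
  assumes "0 < a" "0 < e" "0 < b"
  shows "eventually (\<lambda>l. (b / l) powr a < e) at_top"
proof -
  have "((\<lambda>l. b / l) \<longlongrightarrow> 0) at_top" by (rule real_tendsto_divide_at_top[OF tendsto_const filterlim_ident])
  then have "eventually (\<lambda>l. b / l < e powr (1 / a)) at_top"
    by (rule order_tendstoD(2)) (use assms in simp)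
  then show ?thesis using eventually_gt_at_top[of 0]
  proof eventually_elim
    case (elim l)
    then have "(b / l) powr a < (e powr (1 / a)) powr a"
      using assms by (intro powr_less_mono2) auto
    then show ?case using assms by (simp add: powr_powr)
  qed
qed

text \<open>
  The two ways to make \<open>k\<^sup>p c\<close> small are a vanishing slope \<open>k\<close> and a vanishing density \<open>c\<close>.
\<close>

lemma slice_tendsto_0:
  fixes M :: "'a::metric_space measure" and u :: "'a \<Rightarrow> real"
  assumes M: "sets M = sets borel" and p: "1 \<le> p" and N: "0 < N"
    and L: "0 < L" "\<And>y. \<bar>u x - u y\<bar> \<le> L * dist x y"
    and small: "\<And>e. 0 < e \<Longrightarrow> \<exists>k>0. \<exists>c. k powr p * c \<le> e \<and>
      (\<exists>d>0. \<forall>y. dist x y < d \<longrightarrow> \<bar>u x - u y\<bar> \<le> k * dist x y) \<and>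
      (\<exists>r>0. \<forall>s. 0 < s \<and> s \<le> r \<longrightarrow> emeasure M (ball x s) \<le> ennreal c * ennreal (s powr N))"
  shows "((\<lambda>l. ennreal (l powr p) * emeasure M (Pair x -` E_set p N l u)) \<longlongrightarrow> 0) at_top"
proof (rule order_tendstoI)
  fix a :: ennreal assume "0 < a"
  then obtain a' where a': "0 < a'" "a' < a" using dense by blast
  then obtain e where e: "a' = ennreal e" "0 < e" by (cases a') auto
  obtain k c d r where k: "0 < k" "k powr p * c \<le> e / 2 powr N"
    and d: "0 < d" "\<And>y. dist x y < d \<Longrightarrow> \<bar>u x - u y\<bar> \<le> k * dist x y"
    and r: "0 < r" "\<And>s. 0 < s \<Longrightarrow> s \<le> r \<Longrightarrow> emeasure M (ball x s) \<le> ennreal c * ennreal (s powr N)"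
    using small[of "e / 2 powr N"] e by auto
  have pN: "0 < p / N" using p N by simp
  have "eventually (\<lambda>l. (L / l) powr (p / N) < d) at_top"
    by (rule eventually_divide_powr_less[OF pN d(1) L(1)])
  moreover have "eventually (\<lambda>l. (k / l) powr (p / N) < r / 2) at_top"
    by (rule eventually_divide_powr_less[OF pN _ k(1)]) (use r in simp)
  ultimately show "eventually (\<lambda>l. ennreal (l powr p) * emeasure M (Pair x -` E_set p N l u) < a) at_top"
    using eventually_gt_at_top[of 0]
  proof eventually_elim
    case (elim l)
    have "ennreal (l powr p) * emeasure M (Pair x -` E_set p N l u) \<le> ennreal (2 powr N * k powr p) * ennreal c"
      by (rule slice_bound[OF M p N L elim(3,1) k(1) d(2) _ r(2)]) (use elim in auto)
    also have "\<dots> = ennreal (2 powr N * (k powr p * c))"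
      by (simp add: mult.assoc flip: ennreal_mult')
    also have "\<dots> \<le> ennreal e"
    proof (rule ennreal_leI)
      have "2 powr N * (k powr p * c) \<le> 2 powr N * (e / 2 powr N)" by (intro mult_left_mono k(2)) auto
      then show "2 powr N * (k powr p * c) \<le> e" by simp
    qed
    also have "\<dots> < a" using a' e by simp
    finally show ?case .
  qed
qed simp

section \<open>Measurability of the superlevel set and sigma-finiteness\<close>

lemma E_set_borel:
  fixes u :: "'a::{second_countable_topology, metric_space} \<Rightarrow> real"
  assumes "continuous_on UNIV u"
  shows "E_set p N l u \<in> sets borel"
proof -
  have [measurable]: "u \<in> borel_measurable borel" by (rule borel_measurable_continuous_onI[OF assms])
  have "E_set p N l u = {z \<in> space (borel \<Otimes>\<^sub>M borel). fst z \<noteq> snd z \<and>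
      l * dist (fst z) (snd z) powr (N / p + 1) \<le> \<bar>u (fst z) - u (snd z)\<bar>}"
    unfolding E_set_def by (auto simp: space_pair_measure)
  also have "\<dots> \<in> sets (borel \<Otimes>\<^sub>M borel)" by measurable
  finally show ?thesis unfolding borel_prod .
qed

lemma metric_measure_space_sigma_finite:
  fixes M :: "'a::polish_space measure"
  assumes "metric_measure_space M"
  shows "sigma_finite_measure M"
proof
  have sets: "sets M = sets borel"
    using assms unfolding metric_measure_space_def radon_measure_def by blast
  obtain z :: 'a where True by blast
  define A where "A = range (\<lambda>n::nat. ball z (real n))"
  have "emeasure M (ball z (real n)) < \<infinity>" for n :: nat
    by (rule emeasure_open_bounded_finite[OF assms]) auto
  then have "emeasure M a \<noteq> \<infinity>" if "a \<in> A" for a using that unfolding A_def by (metis imageE less_irrefl)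
  moreover have "\<Union> A = UNIV"
  proof -
    have "x \<in> \<Union> A" for x
      using reals_Archimedean2[of "dist z x"] unfolding A_def by auto
    then show ?thesis by blast
  qed
  moreover have "A \<subseteq> sets M" "countable A" unfolding A_def by (auto simp: sets)
  ultimately show "\<exists>A. countable A \<and> A \<subseteq> sets M \<and> \<Union> A = space M \<and> (\<forall>a\<in>A. emeasure M a \<noteq> \<infinity>)"
    using sets_eq_imp_space_eq[OF sets] by (intro exI[of _ A]) simp
qed

section \<open>Almost everywhere convergence of the slices\<close>

lemma AE_slice_tendsto_0:
  fixes M :: "'a::polish_space measure" and p N :: real and u :: "'a \<Rightarrow> real"
  assumes p: "p \<ge> 1" and N: "0 < N" "N < 1" and X: "lipschitz_differentiability_space M"
    and \<Theta>: "0 < r\<^sub>0" "integrable_on_bounded_sets M (Theta M N r\<^sub>0)"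
    and L: "0 < L" "\<And>x y. \<bar>u x - u y\<bar> \<le> L * dist x y"
  shows "AE x in M. ((\<lambda>l. ennreal (l powr p) * emeasure M (Pair x -` E_set p N l u)) \<longlongrightarrow> 0) at_top"
proof -
  have mms: "metric_measure_space M" using X unfolding lipschitz_differentiability_space_def by blast
  then have sets: "sets M = sets borel" unfolding metric_measure_space_def radon_measure_def by blast
  obtain n U \<phi> where ch: "\<And>i::nat. chart (n i) (U i) (\<phi> i)" "(\<Union>i. U i) = UNIV"
    and diff: "\<And>i u. u \<in> Lip \<Longrightarrow> AE x in M. x \<in> U i \<longrightarrow> chart_differentiable (n i) (\<phi> i) u x"
    using X unfolding lipschitz_differentiability_space_def by metis
  have "u \<in> Lip" unfolding Lip_def using L
    by (auto intro!: exI[of _ L] lipschitz_onI simp: dist_real_def)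
  then have AE1: "AE x in M. \<forall>i. x \<in> U i \<longrightarrow> chart_differentiable (n i) (\<phi> i) u x"
    using diff by (simp add: AE_all_countable)
  \<comment> \<open>The thresholds \<open>1 / (real j + 1)\<close> express vanishing upper density
    by countably many null sets.\<close>
  have AE2: "AE x in M. \<forall>i j::nat. 0 < n i \<longrightarrow> x \<in> U i \<longrightarrow> x \<notin> upper_density_above M N (1 / (real j + 1))"
    unfolding AE_all_countable
  proof (intro allI)
    fix i j :: nat
    show "AE x in M. 0 < n i \<longrightarrow> x \<in> U i \<longrightarrow> x \<notin> upper_density_above M N (1 / (real j + 1))"
    proof (cases "0 < n i")
      case True
      have "emeasure M (upper_density_above M N (1 / (real j + 1)) \<inter> U i) = 0"
        by (rule upper_density_above_null_in_chart[OF mms ch(1) True diff N(2)]) auto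
      moreover have "upper_density_above M N (1 / (real j + 1)) \<inter> U i \<in> sets M"
        using upper_density_above_measurable[OF sets] ch(1)[of i]
        unfolding sets chart_def by (intro sets.Int) auto
      ultimately have "AE x in M. x \<notin> upper_density_above M N (1 / (real j + 1)) \<inter> U i"
        by (intro AE_not_in) (simp add: null_sets_def)
      then show ?thesis by eventually_elim auto
    qed simp
  qed
  obtain z :: 'a where True by blast
  have meas[measurable]: "Theta M N r\<^sub>0 \<in> borel_measurable M"
    using \<Theta>(2) unfolding integrable_on_bounded_sets_def by blast
  have "AE x in M. x \<in> ball z (real m) \<longrightarrow> Theta M N r\<^sub>0 x < \<infinity>" for m :: nat
  proof -
    have B: "ball z (real m) \<in> sets M" by (simp add: sets)
    have "(\<integral>\<^sup>+x\<in>ball z (real m). Theta M N r\<^sub>0 x \<partial>M) < \<infinity>"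
      using \<Theta>(2) B unfolding integrable_on_bounded_sets_def by simp
    then have "AE x in M. Theta M N r\<^sub>0 x * indicator (ball z (real m)) x \<noteq> \<infinity>"
      by (intro nn_integral_PInf_AE) (use B in auto)
    then show ?thesis by eventually_elim (auto simp: less_top)
  qed
  then have "AE x in M. \<forall>m. x \<in> ball z (real m) \<longrightarrow> Theta M N r\<^sub>0 x < \<infinity>"
    unfolding AE_all_countable by blast
  then have AE3: "AE x in M. Theta M N r\<^sub>0 x < \<infinity>"
  proof eventually_elim
    case (elim x)
    obtain m :: nat where "dist z x < real m" using reals_Archimedean2 by blast
    then show ?case using elim[rule_format, of m] by simp
  qed
  show ?thesis using AE1 AE2 AE3
  proof eventually_elim
    case (elim x)
    obtain i where i: "x \<in> U i" using ch(2) by blast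
    show ?case
    proof (rule slice_tendsto_0[OF sets p N(1) L(1) L(2)])
      fix e :: real assume e: "0 < e"
      show "\<exists>k>0. \<exists>c. k powr p * c \<le> e \<and>
        (\<exists>d>0. \<forall>y. dist x y < d \<longrightarrow> \<bar>u x - u y\<bar> \<le> k * dist x y) \<and>
        (\<exists>r>0. \<forall>s. 0 < s \<and> s \<le> r \<longrightarrow> emeasure M (ball x s) \<le> ennreal c * ennreal (s powr N))"
      proof (cases "n i = 0")
        case True
        \<comment> \<open>In dimension 0 the sum in the differential is empty, so \<open>u\<close>
          has slope zero at \<open>x\<close> and the finite bound \<open>\<theta>\<close> on the
          density suffices.\<close>
        obtain D where D: "has_chart_differential (n i) (\<phi> i) u x D"
          using elim(1) i unfolding chart_differentiable_def by blast
        obtain \<theta> where \<theta>: "Theta M N r\<^sub>0 x = ennreal \<theta>" "0 \<le> \<theta>" using elim(3) by (cases "Theta M N r\<^sub>0 x") auto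
        define k where "k = (e / (\<theta> + 1)) powr (1 / p)"
        have k: "0 < k" unfolding k_def using e \<theta>(2) by simp
        have "k powr p * \<theta> \<le> e"
        proof -
          have "k powr p = e / (\<theta> + 1)" unfolding k_def using p e \<theta>(2) by (simp add: powr_powr)
          moreover have "e / (\<theta> + 1) * \<theta> \<le> e"
            using e \<theta>(2) by (simp add: divide_le_eq)
          ultimately show ?thesis by simp
        qed
        moreover obtain d where d: "0 < d" "\<And>y. 0 < dist x y \<Longrightarrow> dist x y < d \<Longrightarrow> \<bar>u y - u x\<bar> \<le> k * dist x y"
          using D[unfolded has_chart_differential_iff, rule_format, OF k] True by auto
        have "\<bar>u x - u y\<bar> \<le> k * dist x y" if "dist x y < d" for y
          using d(2)[of y] that by (cases "x = y") (auto simp: abs_minus_commute)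
        moreover have "emeasure M (ball x s) \<le> ennreal \<theta> * ennreal (s powr N)" if "0 < s" "s \<le> r\<^sub>0" for s
          using Theta_bound[OF that, of M x N] \<theta>(1) by simp
        ultimately show ?thesis using k d(1) \<Theta>(1) by blast
      next
        case False
        \<comment> \<open>In positive dimension the slope is only bounded by \<open>L\<close>, and
          smallness comes from the vanishing density.\<close>
        obtain j where j: "inverse (real (Suc j)) < e / L powr p"
          using reals_Archimedean[of "e / L powr p"] e L(1) by auto
        define c where "c = 1 / (real j + 1)"
        have "c < e / L powr p" using j unfolding c_def by (simp add: inverse_eq_divide add.commute)
        then have "L powr p * c \<le> e" using L(1) by (simp add: field_simps)
        moreover have "x \<notin> upper_density_above M N c" using elim(2) i False unfolding c_def by blast
        then obtain d where d: "0 < d" "\<And>s. 0 < s \<Longrightarrow> s < d \<Longrightarrow> emeasure M (ball x s) \<le> ennreal (c * s powr N)"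
          unfolding upper_density_above_def by (auto simp: not_less) (metis not_le)
        have "emeasure M (ball x s) \<le> ennreal c * ennreal (s powr N)" if "0 < s" "s \<le> d / 2" for s
          using d(2)[of s] that by (simp add: ennreal_mult'')
        moreover have "\<exists>d>0. \<forall>y. dist x y < d \<longrightarrow> \<bar>u x - u y\<bar> \<le> L * dist x y"
          using L(2) by (intro exI[of _ 1]) simp
        ultimately show ?thesis using L(1) half_gt_zero[OF d(1)] by blast
      qed
    qed
  qed
qed

section \<open>Domination of the slices and integration\<close>

theorem theorem4p1:
  fixes M :: "'a::polish_space measure" and p N :: real and u :: "'a \<Rightarrow> real"
  assumes "p \<ge> 1" and "0 < N" and "N < 1"
    and "lipschitz_differentiability_space M"
    and "\<exists>r\<^sub>0>0. integrable_on_bounded_sets M (Theta M N r\<^sub>0)"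
    and "u \<in> Lip_b"
  shows "((\<lambda>l. ennreal (l powr p) * emeasure (M \<Otimes>\<^sub>M M) (E_set p N l u)) \<longlongrightarrow> 0) at_top"
proof -
  have mms: "metric_measure_space M" using assms(4) unfolding lipschitz_differentiability_space_def by blast
  then have sets: "sets M = sets borel" unfolding metric_measure_space_def radon_measure_def by blast
  interpret sigma_finite_measure M by (rule metric_measure_space_sigma_finite[OF mms])
  obtain r\<^sub>0 where r0: "0 < r\<^sub>0" "integrable_on_bounded_sets M (Theta M N r\<^sub>0)" using assms(5) by blast
  obtain L0 where L0: "L0-lipschitz_on UNIV u" and supp: "bounded (closure {x. u x \<noteq> 0})"
    using assms(6) unfolding Lip_b_def Lip_def by blast
  have lip: "(max L0 1)-lipschitz_on UNIV u"
    by (rule lipschitz_on_mono[OF L0 subset_refl max.cobounded1])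
  define L where "L = max L0 1"
  have L: "0 < L" "\<bar>u x - u y\<bar> \<le> L * dist x y" for x y
    using lipschitz_onD[OF lip, of x y] unfolding L_def by (auto simp: dist_real_def)
  define S where "S = {x. u x \<noteq> 0}"
  \<comment> \<open>Outside this neighbourhood of the support, any \<open>y\<close> in the slice has
    distance at least 1, which large \<open>l\<close> excludes.\<close>
  define B where "B = (\<Union>x\<in>S. ball x 1)"
  have "bounded S" unfolding S_def using bounded_subset[OF supp closure_subset] .
  then obtain z R where R: "S \<subseteq> cball z R" using bounded_subset_cball by blast
  have "B \<subseteq> ball z (R + 1)"
  proof -
    have "dist z y < R + 1" if "x \<in> S" "dist x y < 1" for x y
      using R that dist_triangle[of z y x] by force
    then show ?thesis unfolding B_def by auto
  qed
  then have B_bdd: "bounded B" using bounded_subset bounded_ball by blast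
  have B_sets: "B \<in> sets M" unfolding sets B_def by (intro borel_open open_UN ballI open_ball)
  have E_sets: "E_set p N l u \<in> sets (M \<Otimes>\<^sub>M M)" for l
  proof -
    have "sets (M \<Otimes>\<^sub>M M) = sets (borel :: ('a \<times> 'a) measure)"
      using sets_pair_measure_cong[OF sets sets] unfolding borel_prod .
    then show ?thesis using E_set_borel[OF lipschitz_on_continuous_on[OF lip]] by simp
  qed
  define F where "F = (\<lambda>l x. ennreal (l powr p) * emeasure M (Pair x -` E_set p N l u))"
  have F_meas: "F l \<in> borel_measurable M" for l
    unfolding F_def using measurable_emeasure_Pair[OF E_sets] by measurable
  have int: "ennreal (l powr p) * emeasure (M \<Otimes>\<^sub>M M) (E_set p N l u) = (\<integral>\<^sup>+x. F l x \<partial>M)" for l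
    unfolding F_def emeasure_pair_measure_alt[OF E_sets]
    by (intro nn_integral_cmult[symmetric] measurable_emeasure_Pair E_sets)
  \<comment> \<open>The bound of \<open>slice_bound\<close> with slope \<open>L\<close> and density
    \<open>Theta\<close>, which serves as integrable majorant.\<close>
  define w where "w = (\<lambda>x. ennreal (2 powr N * L powr p) * (Theta M N r\<^sub>0 x * indicator B x))"
  have Th[measurable]: "Theta M N r\<^sub>0 \<in> borel_measurable M"
    and Th_int: "(\<integral>\<^sup>+x\<in>B. Theta M N r\<^sub>0 x \<partial>M) < \<infinity>"
    using r0(2) B_sets B_bdd unfolding integrable_on_bounded_sets_def by blast+
  note B_sets[measurable]
  have w_meas: "w \<in> borel_measurable M" unfolding w_def by measurable
  have "(\<integral>\<^sup>+x. w x \<partial>M) = ennreal (2 powr N * L powr p) * (\<integral>\<^sup>+x\<in>B. Theta M N r\<^sub>0 x \<partial>M)"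
    unfolding w_def by (rule nn_integral_cmult) measurable
  also have "\<dots> < \<infinity>" using Th_int by (simp add: ennreal_mult_less_top)
  finally have w_fin: "(\<integral>\<^sup>+x. w x \<partial>M) < \<infinity>" .
  have pN: "0 < p / N" using assms by simp
  \<comment> \<open>\<open>b \<le> 1\<close> empties the slices outside \<open>B\<close>;
    \<open>2 * b \<le> r\<^sub>0\<close> keeps the radius in \<open>slice_bound\<close> within the
    range of \<open>Theta\<close>.\<close>
  define b where "b = min 1 (r\<^sub>0 / 2)"
  have b: "0 < b" "b \<le> 1" "2 * b \<le> r\<^sub>0" using r0 unfolding b_def by auto
  have dom: "F l x \<le> w x" if l: "0 < l" "(L / l) powr (p / N) < b" for l x
  proof (cases "x \<in> B")
    case True
    have "F l x \<le> ennreal (2 powr N * L powr p) * Theta M N r\<^sub>0 x"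
      unfolding F_def
      by (rule slice_bound[OF sets assms(1,2) L(1) L(2) l L(1) L(2) _ Theta_bound])
         (use l b in auto)
    then show ?thesis unfolding w_def using True by simp
  next
    case False
    have "Pair x -` E_set p N l u = {}"
    proof (rule ccontr)
      assume "Pair x -` E_set p N l u \<noteq> {}"
      then obtain y where y: "x \<noteq> y" "l * dist x y powr (N / p + 1) \<le> \<bar>u x - u y\<bar>"
        unfolding E_set_def by auto
      have d: "0 < dist x y" using y by simp
      have "0 < l * dist x y powr (N / p + 1)" using l d by simp
      then have "x \<in> S \<or> y \<in> S" using y(2) unfolding S_def by force
      moreover have "x \<notin> S" using False unfolding B_def by force
      ultimately have "y \<in> S" by blast
      then have "1 \<le> dist x y" using False unfolding B_def by (force simp: dist_commute)
      have "dist x y powr (N / p) \<le> L / l"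
        by (rule powr_le_divide[OF d l(1) order_trans[OF y(2) L(2)]])
      moreover have "1 \<le> dist x y powr (N / p)"
        using \<open>1 \<le> dist x y\<close> assms by (intro ge_one_powr_ge_zero) auto
      ultimately have "1 \<le> L / l" by linarith
      then have "1 \<le> (L / l) powr (p / N)" using pN by (intro ge_one_powr_ge_zero) auto
      then show False using l(2) b(2) by simp
    qed
    then show ?thesis unfolding F_def by simp
  qed
  have "((\<lambda>l. \<integral>\<^sup>+x. F l x \<partial>M) \<longlongrightarrow> 0) at_top"
  \<comment> \<open>Dominated convergence works along sequences; the shift by \<open>n0\<close> is
    made because the majorant is valid only for large \<open>l\<close>.\<close>
  proof (rule tendsto_at_topI_sequentially)
    fix X :: "nat \<Rightarrow> real" assume X: "filterlim X at_top sequentially"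
    have "eventually (\<lambda>n. 0 < X n \<and> (L / X n) powr (p / N) < b) sequentially"
      using X eventually_conj[OF eventually_gt_at_top[of 0] eventually_divide_powr_less[OF pN b(1) L(1)]]
      unfolding filterlim_iff by blast
    then obtain n0 where n0: "\<And>n. n0 \<le> n \<Longrightarrow> 0 < X n \<and> (L / X n) powr (p / N) < b"
      unfolding eventually_sequentially by blast
    have "(\<lambda>n. \<integral>\<^sup>+x. F (X (n + n0)) x \<partial>M) \<longlonglongrightarrow> (\<integral>\<^sup>+x. 0 \<partial>M)"
    proof (rule nn_integral_dominated_convergence[where w=w])
      show "AE x in M. (\<lambda>n. F (X (n + n0)) x) \<longlonglongrightarrow> 0"
        using AE_slice_tendsto_0[OF assms(1-4) r0 L(1) L(2)]
      proof eventually_elim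
        case (elim x)
        have "filterlim (\<lambda>n. X (n + n0)) at_top sequentially"
          by (rule filterlim_compose[OF X filterlim_add_const_nat_at_top])
        then show ?case unfolding F_def by (rule filterlim_compose[OF elim])
      qed
      show "AE x in M. F (X (n + n0)) x \<le> w x" for n
        using dom n0[of "n + n0"] by simp
    qed (use F_meas w_meas w_fin in auto)
    then have "(\<lambda>n. \<integral>\<^sup>+x. F (X (n + n0)) x \<partial>M) \<longlonglongrightarrow> 0" by simp
    then show "(\<lambda>n. \<integral>\<^sup>+x. F (X n) x \<partial>M) \<longlonglongrightarrow> 0" by (rule LIMSEQ_offset)
  qed
  then show ?thesis unfolding int .
qed

end
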